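(* Let $(A;\{E_i\}_{i=0}^d;A^*;\{E^*_i\}_{i=0}^d)$ be a Leonard system in $\mathcal{A}$ with switching element $S$. Let $\mathcal{D}$ denote the subalgebra of $\mathcal{A}$ generated by $A$. Then for all nonzero $X\in\mathcal{A}$ the following (i), (ii) are equivalent. (i) $X$ is a scalar multiple of $S$. (ii) $X\in\mathcal{D}$ and $XE^*_0V\subseteq E^*_dV$. Suppose (i), (ii) hold. Then $XE^*_0V=E^*_dV$.
   Context: $\mathbb{K}$ is a field, $d\ge 0$ an integer, $\mathcal{A}$ a $\mathbb{K}$-algebra isomorphic to $\mathrm{Mat}_{d+1}(\mathbb{K})$, $I$ its identity, and $V$ a simple left $\mathcal{A}$-module (so $\dim V=d+1$). The symbol $A^*$ is just a name for a second element (not a conjugate transpose). An element $A\in\mathcal{A}$ is multiplicity-free if it has $d+1$ mutually distinct eigenvalues in $\mathbb{K}$. For an ordering $\{\theta_i\}_{i=0}^d$ of these eigenvalues, the primitive idempotent of $A$ associated with $\theta_i$ is $E_i=\prod_{0\le j\le d,\,j\ne i}\frac{A-\theta_jI}{\theta_i-\theta_j}$. A Leonard system in $\mathcal{A}$ is a sequence $\Phi=(A;\{E_i\}_{i=0}^d;A^*;\{E^*_i\}_{i=0}^d)$ such that $A,A^*\in\mathcal{A}$ are multiplicity-free; $\{E_i\}_{i=0}^d$ (resp. $\{E^*_i\}_{i=0}^d$) is an ordering of the primitive idempotents of $A$ (resp. $A^*$); and for $0\le i,j\le d$ both $E_iA^*E_j$ and $E^*_iAE^*_j$ are zero if $|i-j|>1$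 and nonzero if $|i-j|=1$. Let $\theta_i$ (resp. $\theta^*_i$) be the eigenvalue of $A$ (resp. $A^*$) associated with $E_i$ (resp. $E^*_i$). Put $\tau_i=(\lambda-\theta_0)(\lambda-\theta_1)\cdots(\lambda-\theta_{i-1})$ and $\eta_i=(\lambda-\theta_d)(\lambda-\theta_{d-1})\cdots(\lambda-\theta_{d-i+1})$ for $0\le i\le d$. The first and second split sequences of $\Phi$ are, for $1\le i\le d$, $\varphi_i=(\theta^*_0-\theta^*_i)\frac{\mathrm{tr}(\tau_i(A)E^*_0)}{\mathrm{tr}(\tau_{i-1}(A)E^*_0)}$ and $\phi_i=(\theta^*_0-\theta^*_i)\frac{\mathrm{tr}(\eta_i(A)E^*_0)}{\mathrm{tr}(\eta_{i-1}(A)E^*_0)}$ (the denominators are known to be nonzero, and all $\varphi_i,\phi_i$ are known to be nonzero). The switching element for $\Phi$ is $S=\sum_{r=0}^d\frac{\phi_d\phi_{d-1}\cdots\phi_{d-r+1}}{\varphi_1\varphi_2\cdots\varphi_r}E_r$. *)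

theory Defs
  imports "Jordan_Normal_Form.Char_Poly" "HOL.Vector_Spaces" "HOL.Hull"
begin

text \<open>
  The algebra is the whole type \<open>'a\<close>, with scalar multiplication \<open>scale\<close>; \<open>\<psi>\<close> is an isomorphism
  onto the full matrix algebra. Eigenvalues and traces of algebra elements are those of their
  \<open>\<psi>\<close>-images; they do not depend on \<open>\<psi>\<close> since any two such isomorphisms differ by a conjugation.
\<close>

locale matrix_algebra = vector_space scale
  for scale :: "'k::field \<Rightarrow> 'a::ring_1 \<Rightarrow> 'a" +
  fixes d :: nat and \<psi> :: "'a \<Rightarrow> 'k mat"
  assumes scale_mult_left: "scale c x * y = scale c (x * y)"
    and scale_mult_right: "x * scale c y = scale c (x * y)"
    and iso_bij: "bij_betw \<psi> UNIV (carrier_mat (Suc d) (Suc d))"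
    and iso_add: "\<psi> (x + y) = \<psi> x + \<psi> y"
    and iso_mult: "\<psi> (x * y) = \<psi> x * \<psi> y"
    and iso_one: "\<psi> 1 = 1\<^sub>m (Suc d)"
    and iso_scale: "\<psi> (scale c x) = c \<cdot>\<^sub>m \<psi> x"

text \<open>
  The scalars act on the module through \<open>scale c 1\<close>, so every submodule is a subspace and no
  separate vector space structure has to be assumed.
\<close>

locale left_module =
  fixes act :: "'a::ring_1 \<Rightarrow> 'v::ab_group_add \<Rightarrow> 'v"
  assumes act_add_left: "act (x + y) v = act x v + act y v"
    and act_add_right: "act x (v + w) = act x v + act x w"
    and act_mult: "act (x * y) v = act x (act y v)"
    and act_one: "act 1 v = v"

definition is_submodule :: "('a \<Rightarrow> 'v::ab_group_add \<Rightarrow> 'v) \<Rightarrow> 'v set \<Rightarrow> bool" where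
  "is_submodule act W \<longleftrightarrow>
     0 \<in> W \<and> (\<forall>v\<in>W. \<forall>w\<in>W. v + w \<in> W) \<and> (\<forall>x. \<forall>w\<in>W. act x w \<in> W)"

locale simple_left_module = left_module act
  for act :: "'a::ring_1 \<Rightarrow> 'v::ab_group_add \<Rightarrow> 'v" +
  assumes nontrivial: "\<exists>v::'v. v \<noteq> 0"
    and simple: "is_submodule act W \<Longrightarrow> W = {0} \<or> W = UNIV"

definition is_subalgebra :: "('k \<Rightarrow> 'a::ring_1 \<Rightarrow> 'a) \<Rightarrow> 'a set \<Rightarrow> bool" where
  "is_subalgebra scale B \<longleftrightarrow>
     1 \<in> B \<and> (\<forall>x\<in>B. \<forall>y\<in>B. x + y \<in> B) \<and> (\<forall>x\<in>B. \<forall>y\<in>B. x * y \<in> B) \<and> (\<forall>c. \<forall>x\<in>B. scale c x \<in> B)"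

definition generated_subalgebra :: "('k \<Rightarrow> 'a::ring_1 \<Rightarrow> 'a) \<Rightarrow> 'a \<Rightarrow> 'a set" where
  "generated_subalgebra scale x = is_subalgebra scale hull {x}"

definition mat_trace :: "'k::comm_monoid_add mat \<Rightarrow> 'k" where
  "mat_trace M = (\<Sum>i<dim_row M. M $$ (i, i))"

definition poly_at :: "('k::field \<Rightarrow> 'a::ring_1 \<Rightarrow> 'a) \<Rightarrow> 'k poly \<Rightarrow> 'a \<Rightarrow> 'a" where
  "poly_at scale p x = (\<Sum>i\<le>degree p. scale (coeff p i) (x ^ i))"

definition multiplicity_free :: "nat \<Rightarrow> ('a \<Rightarrow> 'k::field mat) \<Rightarrow> 'a \<Rightarrow> bool" where
  "multiplicity_free d \<psi> x \<longleftrightarrow> card {t. eigenvalue (\<psi> x) t} = Suc d"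

definition eigenvalue_ordering :: "nat \<Rightarrow> ('a \<Rightarrow> 'k::field mat) \<Rightarrow> 'a \<Rightarrow> (nat \<Rightarrow> 'k) \<Rightarrow> bool" where
  "eigenvalue_ordering d \<psi> x \<theta> \<longleftrightarrow> bij_betw \<theta> {0..d} {t. eigenvalue (\<psi> x) t}"

text \<open>The factors below commute, so the order of the list product is immaterial.\<close>

definition primitive_idempotent ::
    "('k::field \<Rightarrow> 'a::ring_1 \<Rightarrow> 'a) \<Rightarrow> nat \<Rightarrow> 'a \<Rightarrow> (nat \<Rightarrow> 'k) \<Rightarrow> nat \<Rightarrow> 'a" where
  "primitive_idempotent scale d x \<theta> i =
     (\<Prod>j\<leftarrow>filter (\<lambda>j. j \<noteq> i) [0..<Suc d]. scale (1 / (\<theta> i - \<theta> j)) (x - scale (\<theta> j) 1))"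

text \<open>
  \<open>associated_eigenvalues scale d \<psi> x E \<theta>\<close>: \<open>E\<close> is an ordering of the primitive idempotents of
  \<open>x\<close>, and \<open>\<theta> i\<close> is the eigenvalue associated with \<open>E i\<close>. Sequences are functions on
  \<open>nat\<close> of which only the values at indices up to \<open>d\<close> matter; there \<open>E\<close> determines \<open>\<theta>\<close>.
\<close>

definition associated_eigenvalues ::
    "('k::field \<Rightarrow> 'a::ring_1 \<Rightarrow> 'a) \<Rightarrow> nat \<Rightarrow> ('a \<Rightarrow> 'k mat) \<Rightarrow> 'a \<Rightarrow> (nat \<Rightarrow> 'a) \<Rightarrow> (nat \<Rightarrow> 'k) \<Rightarrow> bool" where
  "associated_eigenvalues scale d \<psi> x E \<theta> \<longleftrightarrow>
     eigenvalue_ordering d \<psi> x \<theta> \<and> (\<forall>i\<le>d. E i = primitive_idempotent scale d x \<theta> i)"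

definition tridiagonal_wrt :: "nat \<Rightarrow> (nat \<Rightarrow> 'a::ring_1) \<Rightarrow> 'a \<Rightarrow> bool" where
  "tridiagonal_wrt d E y \<longleftrightarrow>
     (\<forall>i\<le>d. \<forall>j\<le>d.
        (\<bar>int i - int j\<bar> > 1 \<longrightarrow> E i * y * E j = 0) \<and>
        (\<bar>int i - int j\<bar> = 1 \<longrightarrow> E i * y * E j \<noteq> 0))"

definition leonard_system ::
    "('k::field \<Rightarrow> 'a::ring_1 \<Rightarrow> 'a) \<Rightarrow> nat \<Rightarrow> ('a \<Rightarrow> 'k mat) \<Rightarrow>
     'a \<Rightarrow> (nat \<Rightarrow> 'a) \<Rightarrow> 'a \<Rightarrow> (nat \<Rightarrow> 'a) \<Rightarrow> bool" where
  "leonard_system scale d \<psi> A E As Es \<longleftrightarrow>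
     multiplicity_free d \<psi> A \<and> multiplicity_free d \<psi> As \<and>
     (\<exists>\<theta>. associated_eigenvalues scale d \<psi> A E \<theta>) \<and>
     (\<exists>\<theta>s. associated_eigenvalues scale d \<psi> As Es \<theta>s) \<and>
     tridiagonal_wrt d E As \<and> tridiagonal_wrt d Es A"

definition tau :: "(nat \<Rightarrow> 'k::field) \<Rightarrow> nat \<Rightarrow> 'k poly" where
  "tau \<theta> i = (\<Prod>j<i. [:- \<theta> j, 1:])"

definition eta :: "nat \<Rightarrow> (nat \<Rightarrow> 'k::field) \<Rightarrow> nat \<Rightarrow> 'k poly" where
  "eta d \<theta> i = (\<Prod>j<i. [:- \<theta> (d - j), 1:])"

definition first_split ::
    "('k::field \<Rightarrow> 'a::ring_1 \<Rightarrow> 'a) \<Rightarrow> ('a \<Rightarrow> 'k mat) \<Rightarrow>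
     'a \<Rightarrow> (nat \<Rightarrow> 'k) \<Rightarrow> (nat \<Rightarrow> 'a) \<Rightarrow> (nat \<Rightarrow> 'k) \<Rightarrow> nat \<Rightarrow> 'k" where
  "first_split scale \<psi> A \<theta> Es \<theta>s i =
     (\<theta>s 0 - \<theta>s i) *
       (mat_trace (\<psi> (poly_at scale (tau \<theta> i) A * Es 0)) /
        mat_trace (\<psi> (poly_at scale (tau \<theta> (i - 1)) A * Es 0)))"

definition second_split ::
    "('k::field \<Rightarrow> 'a::ring_1 \<Rightarrow> 'a) \<Rightarrow> nat \<Rightarrow> ('a \<Rightarrow> 'k mat) \<Rightarrow>
     'a \<Rightarrow> (nat \<Rightarrow> 'k) \<Rightarrow> (nat \<Rightarrow> 'a) \<Rightarrow> (nat \<Rightarrow> 'k) \<Rightarrow> nat \<Rightarrow> 'k" where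
  "second_split scale d \<psi> A \<theta> Es \<theta>s i =
     (\<theta>s 0 - \<theta>s i) *
       (mat_trace (\<psi> (poly_at scale (eta d \<theta> i) A * Es 0)) /
        mat_trace (\<psi> (poly_at scale (eta d \<theta> (i - 1)) A * Es 0)))"

definition switching_element ::
    "('k::field \<Rightarrow> 'a::ring_1 \<Rightarrow> 'a) \<Rightarrow> nat \<Rightarrow> ('a \<Rightarrow> 'k mat) \<Rightarrow>
     'a \<Rightarrow> (nat \<Rightarrow> 'a) \<Rightarrow> (nat \<Rightarrow> 'k) \<Rightarrow> (nat \<Rightarrow> 'a) \<Rightarrow> (nat \<Rightarrow> 'k) \<Rightarrow> 'a" where
  "switching_element scale d \<psi> A E \<theta> Es \<theta>s =
     (\<Sum>r\<le>d. scale
        ((\<Prod>h\<in>{Suc d - r..d}. second_split scale d \<psi> A \<theta> Es \<theta>s h) /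
         (\<Prod>h\<in>{1..r}. first_split scale \<psi> A \<theta> Es \<theta>s h))
        (E r))"

end

theory Submission
  imports Defs
begin

text \<open>
  Let \<open>u\<close> span \<open>E\<^sup>*\<^sub>0V\<close>. Every vector has the form \<open>p(A) u\<close> with \<open>p\<close> a polynomial (\<open>column_eq_poly'\<close>), because the irreducible
  tridiagonal action of \<open>A\<close> on the eigenspaces of \<open>A\<^sup>*\<close> moves \<open>u\<close> up by exactly one eigenspace at each
  power. Hence some nonzero \<open>X = p(A)\<close> carries \<open>E\<^sup>*\<^sub>0V\<close> into \<open>E\<^sup>*\<^sub>dV\<close>, and everything comes down to
  computing the eigenvalues \<open>p(\<theta>\<^sub>r)\<close> of such an \<open>X\<close> up to a common factor.

  The vectors \<open>\<tau>\<^sub>i(A) u\<close> form the split basis: \<open>(A\<^sup>* - \<theta>\<^sup>*\<^sub>i) \<tau>\<^sub>i(A) u = c\<^sub>i \<tau>\<^sub>i\<^sub>-\<^sub>1(A) u\<close> with \<open>c\<^sub>i\<close> the first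
  split sequence (\<open>split\<close>). Its \<open>E\<^sub>i\<^sub>-\<^sub>1\<close> component expresses
  \<open>E\<^sub>i\<^sub>-\<^sub>1 A\<^sup>* E\<^sub>i u\<close> through \<open>c\<^sub>i\<close>. The vector \<open>X u\<close> lies in \<open>E\<^sup>*\<^sub>dV\<close>, so the same relation holds
  for it with the split sequence of the system in which the order of the \<open>E\<^sup>*\<^sub>i\<close> is reversed. As
  \<open>E\<^sub>i X u = p(\<theta>\<^sub>i) E\<^sub>i u\<close>, comparing the two relations shows that \<open>p(\<theta>\<^sub>i) / p(\<theta>\<^sub>i\<^sub>-\<^sub>1)\<close> is the
  quotient of the two split sequences at \<open>i\<close> (\<open>eigenvalue_ratio\<close>).

  It remains to identify the split sequence of the reversed system: its term at \<open>i\<close> is the second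
  split sequence of the given system at \<open>d - i + 1\<close> (\<open>first_split_reverse_Es\<close>). For this one evaluates
  \<open>E\<^sup>*\<^sub>0 \<eta>\<^sub>j(A) (A\<^sup>* - t) \<tau>\<^sub>i(A) E\<^sup>*\<^sub>d\<close> with \<open>j = d - i + 1\<close>, letting the middle factor act to the left and
  to the right. The left action obeys the same split relation because all polynomials in \<open>A\<close> are
  symmetric up to a diagonal rescaling (\<open>symmetrizing_weights\<close>). The two results agree
  because \<open>E\<^sup>*\<^sub>0 p(A) E\<^sup>*\<^sub>d\<close> depends only on the coefficient of \<open>p\<close> in degree \<open>d\<close>
  when \<open>p\<close> has degree at most \<open>d\<close>. The ratios are then those of the eigenvalues of the switching
  element, which gives uniqueness and, since a nonzero \<open>X\<close> exists, also that the switching element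
  itself has the required property.

  The computation is done inside the algebra, in matrix coordinates for which \<open>A\<^sup>*\<close> is diagonal, with
  elements \<open>x E\<^sup>*\<^sub>0\<close> in the role of vectors. As the module is faithful (\<open>act_faithful\<close>), containments
  between subspaces of \<open>V\<close> translate into identities in the algebra.
\<close>

section \<open>Coordinates on a matrix algebra\<close>

text \<open>
  The isomorphism with the matrix algebra, given by its entries at indices up to \<open>d\<close>. Writing
  entries as functions avoids carriers and dimensions in all later computations.
\<close>
locale matrix_coordinates = vector_space scale
  for scale :: "'k::field \<Rightarrow> 'a::ring_1 \<Rightarrow> 'a" +
  fixes d :: nat and ent :: "'a \<Rightarrow> nat \<Rightarrow> nat \<Rightarrow> 'k"
  assumes scale_mult_left: "scale c x * y = scale c (x * y)"
    and scale_mult_right: "x * scale c y = scale c (x * y)"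
    and ent_add: "\<lbrakk>i \<le> d; j \<le> d\<rbrakk> \<Longrightarrow> ent (x + y) i j = ent x i j + ent y i j"
    and ent_mult: "\<lbrakk>i \<le> d; j \<le> d\<rbrakk> \<Longrightarrow> ent (x * y) i j = (\<Sum>k\<le>d. ent x i k * ent y k j)"
    and ent_one: "\<lbrakk>i \<le> d; j \<le> d\<rbrakk> \<Longrightarrow> ent 1 i j = (if i = j then 1 else 0)"
    and ent_scale: "\<lbrakk>i \<le> d; j \<le> d\<rbrakk> \<Longrightarrow> ent (scale c x) i j = c * ent x i j"
    and ent_ext: "(\<And>i j. \<lbrakk>i \<le> d; j \<le> d\<rbrakk> \<Longrightarrow> ent x i j = ent y i j) \<Longrightarrow> x = y"
    and ent_surj: "\<exists>x. \<forall>i\<le>d. \<forall>j\<le>d. ent x i j = f i j"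
begin

lemma ent_zero: "\<lbrakk>i \<le> d; j \<le> d\<rbrakk> \<Longrightarrow> ent 0 i j = 0"
  using ent_scale[of i j 0 0] by simp

lemma ent_diff: "\<lbrakk>i \<le> d; j \<le> d\<rbrakk> \<Longrightarrow> ent (x - y) i j = ent x i j - ent y i j"
  using ent_add[of i j "x - y" y] by simp

lemma ent_sum: "\<lbrakk>i \<le> d; j \<le> d\<rbrakk> \<Longrightarrow> ent (\<Sum>l\<in>I. f l) i j = (\<Sum>l\<in>I. ent (f l) i j)"
  by (induction I rule: infinite_finite_induct) (simp_all add: ent_zero ent_add)

text \<open>
  Simplicity of the matrix algebra: a nonzero entry of \<open>y\<close> can be moved by matrix units, one on each
  side, to any diagonal position and scaled to \<open>1\<close>.
\<close>
lemma one_in_ideal: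
  fixes y :: 'a
  assumes "y \<noteq> 0"
  shows "\<exists>u w. (\<Sum>k\<le>d. u k * y * w k) = 1"
proof -
  obtain a b where ab: "a \<le> d" "b \<le> d" "ent y a b \<noteq> 0"
    using assms ent_ext[of y 0] by (auto simp: ent_zero)
  have "\<forall>k. \<exists>u. \<forall>i\<le>d. \<forall>j\<le>d. ent u i j = (if i = k \<and> j = a then 1 / ent y a b else 0)"
    by (intro allI ent_surj)
  then obtain u where
    u: "\<And>k i j. \<lbrakk>i \<le> d; j \<le> d\<rbrakk> \<Longrightarrow> ent (u k) i j = (if i = k \<and> j = a then 1 / ent y a b else 0)"
    by metis
  have "\<forall>k. \<exists>w. \<forall>i\<le>d. \<forall>j\<le>d. ent w i j = (if i = b \<and> j = k then 1 else 0)"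
    by (intro allI ent_surj)
  then obtain w where
    w: "\<And>k i j. \<lbrakk>i \<le> d; j \<le> d\<rbrakk> \<Longrightarrow> ent (w k) i j = (if i = b \<and> j = k then 1 else 0)"
    by metis
  have uy: "ent (u k * y) i j = (if i = k then ent y a j / ent y a b else 0)"
    if "i \<le> d" "j \<le> d" for i j k
  proof -
    have "ent (u k * y) i j = (\<Sum>l\<le>d. if l = a then (if i = k then ent y a j / ent y a b else 0) else 0)"
      unfolding ent_mult[OF that] by (rule sum.cong) (auto simp: u that)
    then show ?thesis using ab by simp
  qed
  have uyw: "ent (u k * y * w k) i j = (if i = k \<and> j = k then 1 else 0)"
    if "i \<le> d" "j \<le> d" for i j k
  proof -
    have "ent (u k * y * w k) i j = (\<Sum>l\<le>d. if l = b then (if i = k \<and> j = k then 1 else 0) else 0)"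
      unfolding ent_mult[OF that] by (rule sum.cong) (auto simp: uy w that ab)
    then show ?thesis using ab by simp
  qed
  have "(\<Sum>k\<le>d. u k * y * w k) = 1"
  proof (rule ent_ext)
    fix i j assume ij: "i \<le> d" "j \<le> d"
    have "ent (\<Sum>k\<le>d. u k * y * w k) i j = (\<Sum>k\<le>d. if k = i then (if i = j then 1 else 0) else 0)"
      unfolding ent_sum[OF ij] by (rule sum.cong) (auto simp: uyw ij)
    then show "ent (\<Sum>k\<le>d. u k * y * w k) i j = ent 1 i j"
      using ij by (simp add: ent_one)
  qed
  then show ?thesis by blast
qed

end

section \<open>Diagonalizing a multiplicity-free element\<close>

lemma mat_trace_comm:
  fixes X Y :: "'k::comm_semiring_0 mat"
  assumes "X \<in> carrier_mat n n" "Y \<in> carrier_mat n n"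
  shows "mat_trace (X * Y) = mat_trace (Y * X)"
proof -
  have "mat_trace (X * Y) = (\<Sum>i<n. \<Sum>j<n. X $$ (i, j) * Y $$ (j, i))"
    using assms by (simp add: mat_trace_def scalar_prod_def atLeast0LessThan)
  also have "\<dots> = (\<Sum>j<n. \<Sum>i<n. Y $$ (j, i) * X $$ (i, j))"
    by (subst sum.swap) (simp add: mult.commute)
  also have "\<dots> = mat_trace (Y * X)"
    using assms by (simp add: mat_trace_def scalar_prod_def atLeast0LessThan)
  finally show ?thesis .
qed

lemma index_mult_mat_sum:
  fixes X Y :: "'k::semiring_0 mat"
  assumes "X \<in> carrier_mat n n" "Y \<in> carrier_mat n n" "i < n" "j < n"
  shows "(X * Y) $$ (i, j) = (\<Sum>k<n. X $$ (i, k) * Y $$ (k, j))"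
  using assms by (simp add: scalar_prod_def atLeast0LessThan)

lemma smult_mat_mult_vec:
  fixes X :: "'k::comm_semiring_0 mat"
  assumes "X \<in> carrier_mat m n" "v \<in> carrier_vec n"
  shows "(c \<cdot>\<^sub>m X) *\<^sub>v v = c \<cdot>\<^sub>v (X *\<^sub>v v)"
  using assms by (intro eq_vecI) (auto simp: scalar_prod_def sum_distrib_left mult.assoc)

lemma mult_unit_vec_eq_col:
  fixes X :: "'k::semiring_1 mat"
  assumes "X \<in> carrier_mat m n" "i < n"
  shows "X *\<^sub>v unit_vec n i = col X i"
  using assms by (intro eq_vecI) auto

abbreviation diagonal :: "nat \<Rightarrow> (nat \<Rightarrow> 'k::zero) \<Rightarrow> 'k mat" where
  "diagonal n a \<equiv> mat n n (\<lambda>(i, j). if i = j then a i else 0)"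

context matrix_algebra
begin

lemma iso_carrier: "\<psi> y \<in> carrier_mat (Suc d) (Suc d)"
  using iso_bij by (auto simp: bij_betw_def)

lemma iso_prod_list_eigenvector:
  assumes v: "v \<in> carrier_vec (Suc d)"
    and "\<And>y. y \<in> set ys \<Longrightarrow> \<psi> (f y) *\<^sub>v v = g y \<cdot>\<^sub>v v"
  shows "\<psi> (\<Prod>y\<leftarrow>ys. f y) *\<^sub>v v = (\<Prod>y\<leftarrow>ys. g y) \<cdot>\<^sub>v v"
  using assms(2)
proof (induction ys)
  case Nil
  then show ?case using v by (simp add: iso_one)
next
  case (Cons y ys)
  have "\<psi> (f y * (\<Prod>y\<leftarrow>ys. f y)) *\<^sub>v v = \<psi> (f y) *\<^sub>v (\<psi> (\<Prod>y\<leftarrow>ys. f y) *\<^sub>v v)"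
    unfolding iso_mult by (rule assoc_mult_mat_vec[OF iso_carrier iso_carrier v])
  also have "\<dots> = (\<Prod>y\<leftarrow>ys. g y) \<cdot>\<^sub>v (\<psi> (f y) *\<^sub>v v)"
    using Cons mult_mat_vec[OF iso_carrier v] by simp
  also have "\<dots> = (\<Prod>y\<leftarrow>y # ys. g y) \<cdot>\<^sub>v v"
    using Cons.prems by (simp add: smult_smult_assoc mult.commute)
  finally show ?case by simp
qed

text \<open>
  The primitive idempotent is the Lagrange polynomial of the eigenvalues, evaluated at \<open>x\<close>. This
  description on eigenvectors determines it once the eigenvectors are known to form a basis.
\<close>
lemma primitive_idempotent_eigenvector:
  assumes v: "v \<in> carrier_vec (Suc d)" and xv: "\<psi> x *\<^sub>v v = \<theta> k \<cdot>\<^sub>v v"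
    and inj: "inj_on \<theta> {0..d}" and ik: "i \<le> d" "k \<le> d"
  shows "\<psi> (primitive_idempotent scale d x \<theta> i) *\<^sub>v v = (if k = i then 1 else 0) \<cdot>\<^sub>v v"
proof -
  let ?js = "filter (\<lambda>j. j \<noteq> i) [0..<Suc d]"
  have factor: "\<psi> (scale (1 / (\<theta> i - \<theta> j)) (x - scale (\<theta> j) 1)) *\<^sub>v v
      = ((\<theta> k - \<theta> j) / (\<theta> i - \<theta> j)) \<cdot>\<^sub>v v" for j
  proof -
    have "x - scale (\<theta> j) 1 = x + scale (- \<theta> j) 1" by simp
    then have "\<psi> (scale (1 / (\<theta> i - \<theta> j)) (x - scale (\<theta> j) 1))
        = (1 / (\<theta> i - \<theta> j)) \<cdot>\<^sub>m (\<psi> x + (- \<theta> j) \<cdot>\<^sub>m 1\<^sub>m (Suc d))"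
      by (simp only: iso_scale iso_add iso_one)
    also have "\<dots> *\<^sub>v v = (1 / (\<theta> i - \<theta> j)) \<cdot>\<^sub>v (\<psi> x *\<^sub>v v + (- \<theta> j) \<cdot>\<^sub>v v)"
      using v iso_carrier[of x]
      by (simp add: smult_mat_mult_vec[of _ "Suc d" "Suc d"]
          add_mult_distrib_mat_vec[of _ "Suc d" "Suc d"])
    also have "\<dots> = ((\<theta> k - \<theta> j) / (\<theta> i - \<theta> j)) \<cdot>\<^sub>v v"
      using v by (intro eq_vecI) (auto simp: xv diff_divide_distrib left_diff_distrib)
    finally show ?thesis .
  qed
  have "\<psi> (primitive_idempotent scale d x \<theta> i) *\<^sub>v v
      = (\<Prod>j\<leftarrow>?js. (\<theta> k - \<theta> j) / (\<theta> i - \<theta> j)) \<cdot>\<^sub>v v"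
    unfolding primitive_idempotent_def by (rule iso_prod_list_eigenvector[OF v factor])
  also have "(\<Prod>j\<leftarrow>?js. (\<theta> k - \<theta> j) / (\<theta> i - \<theta> j)) = (if k = i then 1 else 0)"
  proof (cases "k = i")
    case True
    have "(\<theta> k - \<theta> j) / (\<theta> i - \<theta> j) = 1" if "j \<in> set ?js" for j
    proof -
      have "j \<le> d" "j \<noteq> i" using that by (auto simp del: upt_Suc)
      then show ?thesis using inj_onD[OF inj, of i j] ik True by auto
    qed
    then have "map (\<lambda>j. (\<theta> k - \<theta> j) / (\<theta> i - \<theta> j)) ?js = map (\<lambda>j. 1) ?js"
      by (intro map_cong refl)
    moreover have "prod_list (map (\<lambda>j. 1 :: 'k) js) = 1" for js :: "nat list"
      by (induction js) simp_all
    ultimately show ?thesis using True by (simp only: simp_thms if_True)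
  next
    case False
    then have "k \<in> set ?js" using ik by (auto simp del: upt_Suc)
    moreover have "0 = (\<theta> k - \<theta> k) / (\<theta> i - \<theta> k)" by simp
    ultimately have "(0::'k) \<in> set (map (\<lambda>j. (\<theta> k - \<theta> j) / (\<theta> i - \<theta> j)) ?js)"
      unfolding set_map by (rule rev_image_eqI)
    then show ?thesis using False by (simp only: prod_list_zero_iff if_False)
  qed
  finally show ?thesis .
qed

text \<open>This allows to pass from the given isomorphism to a basis of eigenvectors.\<close>
lemma coordinates_of_conjugation:
  assumes P: "P \<in> carrier_mat (Suc d) (Suc d)" and Q: "Q \<in> carrier_mat (Suc d) (Suc d)"
    and PQ: "P * Q = 1\<^sub>m (Suc d)" and QP: "Q * P = 1\<^sub>m (Suc d)"
  shows "matrix_coordinates scale d (\<lambda>y i j. (Q * (\<psi> y * P)) $$ (i, j))"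
    and "mat_trace (\<psi> y) = (\<Sum>i\<le>d. (Q * (\<psi> y * P)) $$ (i, i))"
proof -
  let ?n = "Suc d" and ?C = "\<lambda>y. Q * (\<psi> y * P)"
  have C: "?C y \<in> carrier_mat ?n ?n" for y using P Q iso_carrier[of y] by simp
  have recover: "P * (?C y) * Q = \<psi> y" for y
  proof -
    have "P * (Q * (\<psi> y * P)) = (P * Q) * (\<psi> y * P)"
      using P Q iso_carrier[of y] by (simp add: assoc_mult_mat[of _ ?n ?n _ ?n _ ?n])
    also have "\<dots> = \<psi> y * P" using P iso_carrier[of y] by (simp add: PQ)
    also have "\<dots> * Q = \<psi> y * (P * Q)"
      using P Q iso_carrier[of y] by (simp add: assoc_mult_mat[of _ ?n ?n _ ?n _ ?n])
    also have "\<dots> = \<psi> y" using iso_carrier[of y] by (simp add: PQ)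
    finally show ?thesis .
  qed
  have C_mult: "?C (x * y) = ?C x * ?C y" for x y
  proof -
    have "\<psi> x * \<psi> y = \<psi> x * (P * ?C y * Q)" by (simp only: recover)
    then have "?C (x * y) = Q * (\<psi> x * (P * ?C y * Q) * P)" by (simp only: iso_mult)
    also have "\<dots> = Q * (\<psi> x * P) * (?C y * (Q * P))"
      using P Q iso_carrier[of x] C[of y] by (simp add: assoc_mult_mat[of _ ?n ?n _ ?n _ ?n])
    also have "\<dots> = ?C x * ?C y" by (simp only: QP right_mult_one_mat[OF C])
    finally show ?thesis .
  qed
  show "matrix_coordinates scale d (\<lambda>y i j. ?C y $$ (i, j))"
  proof unfold_locales
    fix i j x y c assume ij: "i \<le> d" "j \<le> d"
    have "?C (x + y) = ?C x + ?C y"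
      using P Q iso_carrier[of x] iso_carrier[of y]
      by (simp add: iso_add add_mult_distrib_mat[of _ ?n ?n]
          mult_add_distrib_mat[OF Q mult_carrier_mat[OF iso_carrier P] mult_carrier_mat[OF iso_carrier P]])
    then show "?C (x + y) $$ (i, j) = ?C x $$ (i, j) + ?C y $$ (i, j)"
      using ij C[of x] C[of y] by (auto simp del: index_mult_mat)
    show "?C (x * y) $$ (i, j) = (\<Sum>k\<le>d. ?C x $$ (i, k) * ?C y $$ (k, j))"
      unfolding C_mult using index_mult_mat_sum[OF C C, of i j x y] ij
      by (simp only: less_Suc_eq_le lessThan_Suc_atMost)
    have "?C (scale c x) = c \<cdot>\<^sub>m ?C x"
      using P Q iso_carrier[of x]
      by (simp add: iso_scale mult_smult_assoc_mat[of _ ?n ?n] 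
          mult_smult_distrib[OF Q mult_carrier_mat[OF iso_carrier P]])
    then show "?C (scale c x) $$ (i, j) = c * ?C x $$ (i, j)"
      using ij C[of x] by (auto simp del: index_mult_mat)
    show "?C 1 $$ (i, j) = (if i = j then 1 else 0)"
      using P ij by (simp add: iso_one QP del: index_mult_mat)
  next
    fix x y assume *: "\<And>i j. \<lbrakk>i \<le> d; j \<le> d\<rbrakk> \<Longrightarrow> ?C x $$ (i, j) = ?C y $$ (i, j)"
    have "?C x = ?C y"
      using * C[of x] C[of y] by (intro eq_matI) (auto simp del: index_mult_mat simp: less_Suc_eq_le)
    from arg_cong[OF this, of "\<lambda>Z. P * Z * Q"] have "\<psi> x = \<psi> y" by (simp only: recover)
    then show "x = y" using iso_bij by (simp add: bij_betw_def inj_on_def)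
  next
    fix f :: "nat \<Rightarrow> nat \<Rightarrow> 'k"
    let ?F = "mat ?n ?n (\<lambda>(i, j). f i j)"
    have F: "?F \<in> carrier_mat ?n ?n" by simp
    have "P * ?F * Q \<in> carrier_mat ?n ?n"
      by (rule mult_carrier_mat[OF mult_carrier_mat[OF P F] Q])
    then obtain x where x: "\<psi> x = P * ?F * Q"
      using iso_bij by (metis bij_betw_imp_surj_on imageE)
    have PF: "P * ?F \<in> carrier_mat ?n ?n" by (rule mult_carrier_mat[OF P F])
    have "\<psi> x * P = P * ?F"
      unfolding x assoc_mult_mat[OF PF Q P] QP by (rule right_mult_one_mat[OF PF])
    then have "?C x = Q * P * ?F" by (simp only: assoc_mult_mat[OF Q P F])
    also have "\<dots> = ?F" unfolding QP by (rule left_mult_one_mat[OF F])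
    finally have "\<forall>i\<le>d. \<forall>j\<le>d. ?C x $$ (i, j) = f i j" by (simp del: index_mult_mat)
    then show "\<exists>x. \<forall>i\<le>d. \<forall>j\<le>d. ?C x $$ (i, j) = f i j" by blast
  qed (rule scale_mult_left scale_mult_right)+
  have "mat_trace (?C y) = mat_trace (\<psi> y * P * Q)"
    using P Q iso_carrier[of y] by (intro mat_trace_comm) auto
  also have "\<psi> y * P * Q = \<psi> y"
    using P Q PQ iso_carrier[of y] by (simp add: assoc_mult_mat[of _ ?n ?n _ ?n _ ?n])
  finally show "mat_trace (\<psi> y) = (\<Sum>i\<le>d. ?C y $$ (i, i))"
    using C[of y] by (simp only: mat_trace_def carrier_matD lessThan_Suc_atMost)
qed

text \<open>
  Conjugate by the matrix \<open>P\<close> whose columns are eigenvectors for the distinct eigenvalues. It is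
  invertible because the primitive idempotents separate its columns: if \<open>P c = 0\<close>, then applying the
  idempotent with index \<open>i\<close> leaves \<open>c\<^sub>i v\<^sub>i = 0\<close>.
\<close>
lemma diagonalizing_coordinates:
  assumes "associated_eigenvalues scale d \<psi> x E \<theta>"
  shows "\<exists>ent. matrix_coordinates scale d ent \<and> (\<forall>y. mat_trace (\<psi> y) = (\<Sum>i\<le>d. ent y i i)) \<and>
    (\<forall>i\<le>d. \<forall>j\<le>d. ent x i j = (if i = j then \<theta> i else 0)) \<and>
    (\<forall>r\<le>d. \<forall>i\<le>d. \<forall>j\<le>d. ent (E r) i j = (if i = r \<and> j = r then 1 else 0))"
proof -
  let ?n = "Suc d"
  have bij: "bij_betw \<theta> {0..d} {t. eigenvalue (\<psi> x) t}"
    and E: "\<And>i. i \<le> d \<Longrightarrow> E i = primitive_idempotent scale d x \<theta> i"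
    using assms by (auto simp: associated_eigenvalues_def eigenvalue_ordering_def)
  have inj: "inj_on \<theta> {0..d}" using bij by (rule bij_betw_imp_inj_on)
  have "\<exists>v. eigenvector (\<psi> x) v (\<theta> k)" if "k \<le> d" for k
    using bij_betwE[OF bij] that by (auto simp: eigenvalue_def)
  then obtain v where "\<And>k. k \<le> d \<Longrightarrow> eigenvector (\<psi> x) (v k) (\<theta> k)" by metis
  then have v: "v k \<in> carrier_vec ?n" "v k \<noteq> 0\<^sub>v ?n" "\<psi> x *\<^sub>v v k = \<theta> k \<cdot>\<^sub>v v k" if "k \<le> d" for k
    using that iso_carrier[of x] by (auto simp: eigenvector_def)
  have Ev: "\<psi> (E i) *\<^sub>v v k = (if k = i then 1 else 0) \<cdot>\<^sub>v v k" if "i \<le> d" "k \<le> d" for i k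
    using primitive_idempotent_eigenvector[OF v(1,3)[OF that(2)] inj that] by (simp only: E[OF that(1)])
  define P where "P = mat ?n ?n (\<lambda>(i, k). v k $ i)"
  have P: "P \<in> carrier_mat ?n ?n" by (simp add: P_def)
  have colP: "col P k = v k" if "k \<le> d" for k
    using that v(1)[OF that] by (intro eq_vecI) (auto simp: P_def)
  have diag: "\<psi> y * P = P * diagonal ?n a"
    if "\<And>k. k \<le> d \<Longrightarrow> \<psi> y *\<^sub>v v k = a k \<cdot>\<^sub>v v k" for y a
  proof (rule eq_matI)
    fix i k assume "i < dim_row (P * diagonal ?n a)" "k < dim_col (P * diagonal ?n a)"
    then have ik: "i < ?n" "k < ?n" using P by auto
    have "(\<psi> y * P) $$ (i, k) = (\<psi> y *\<^sub>v v k) $ i"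
      using ik P iso_carrier[of y] colP[of k] by simp
    also have "\<dots> = a k * v k $ i"
      using ik that[of k] v(1)[of k] by simp
    also have "\<dots> = (\<Sum>l<?n. if l = k then a k * v k $ i else 0)"
      using ik by simp
    also have "\<dots> = (\<Sum>l<?n. P $$ (i, l) * diagonal ?n a $$ (l, k))"
      using ik by (intro sum.cong) (auto simp: P_def)
    also have "\<dots> = (P * diagonal ?n a) $$ (i, k)"
      using index_mult_mat_sum[OF P _ ik, of "diagonal ?n a"] by simp
    finally show "(\<psi> y * P) $$ (i, k) = (P * diagonal ?n a) $$ (i, k)" .
  qed (use P iso_carrier[of y] in auto)
  have "det P \<noteq> 0"
  proof
    assume "det P = 0"
    then obtain c where c: "c \<in> carrier_vec ?n" "c \<noteq> 0\<^sub>v ?n" "P *\<^sub>v c = 0\<^sub>v ?n"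
      using det_0_iff_vec_prod_zero[OF P] by blast
    then obtain i where i: "i < ?n" "c $ i \<noteq> 0"
      by (metis carrier_vecD dim_vec eq_vecI index_zero_vec)
    \<comment> \<open>the idempotent with index \<open>i\<close>, as seen from the basis of eigenvectors\<close>
    let ?D = "diagonal ?n (\<lambda>k. if k = i then 1 else (0::'k))"
    have D: "?D \<in> carrier_mat ?n ?n" by simp
    have "P *\<^sub>v (?D *\<^sub>v c) = (\<psi> (E i) * P) *\<^sub>v c"
      using i diag[of "E i" "\<lambda>k. if k = i then 1 else 0"] Ev assoc_mult_mat_vec[OF P D c(1)] by simp
    also have "\<dots> = \<psi> (E i) *\<^sub>v (P *\<^sub>v c)" by (rule assoc_mult_mat_vec[OF iso_carrier P c(1)])
    also have "\<dots> = 0\<^sub>v ?n" unfolding c(3) using iso_carrier[of "E i"] by auto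
    finally have zero: "P *\<^sub>v (?D *\<^sub>v c) = 0\<^sub>v ?n" .
    have "?D *\<^sub>v c = c $ i \<cdot>\<^sub>v unit_vec ?n i"
    proof (rule eq_vecI)
      fix r assume "r < dim_vec (c $ i \<cdot>\<^sub>v unit_vec ?n i)"
      then have r: "r < ?n" by simp
      have "(?D *\<^sub>v c) $ r = (\<Sum>k<?n. (if r = k then (if r = i then 1 else 0) else 0) * c $ k)"
        using r c(1) by (simp add: scalar_prod_def atLeast0LessThan del: sum.lessThan_Suc)
      also have "\<dots> = (\<Sum>k<?n. if k = r then (if r = i then c $ i else 0) else 0)"
        by (rule sum.cong) auto
      also have "\<dots> = (if r = i then c $ i else 0)" using r by (simp del: sum.lessThan_Suc)
      finally show "(?D *\<^sub>v c) $ r = (c $ i \<cdot>\<^sub>v unit_vec ?n i) $ r"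
        using r i by simp
    qed simp
    then have "P *\<^sub>v (?D *\<^sub>v c) = c $ i \<cdot>\<^sub>v v i"
      using mult_mat_vec[OF P unit_vec_carrier] mult_unit_vec_eq_col[OF P] i colP[of i] by simp
    then have "v i = 0\<^sub>v ?n" using zero i v(1)[of i]
      by (metis less_Suc_eq_le carrier_vecD index_smult_vec(1) index_zero_vec(1) eq_vecI index_zero_vec(2) mult_eq_0_iff)
    then show False using v(2) i by simp
  qed
  from det_non_zero_imp_unit[OF P this, of "()"]
  obtain Q where Q: "Q \<in> carrier_mat ?n ?n" and QP: "Q * P = 1\<^sub>m ?n" and PQ: "P * Q = 1\<^sub>m ?n"
    by (auto simp: Units_def ring_mat_def)
  have entries: "(Q * (\<psi> y * P)) $$ (i, j) = (if i = j then a i else 0)"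
    if "\<And>k. k \<le> d \<Longrightarrow> \<psi> y *\<^sub>v v k = a k \<cdot>\<^sub>v v k" "i \<le> d" "j \<le> d" for y a i j
  proof -
    have D: "diagonal ?n a \<in> carrier_mat ?n ?n" by simp
    have "Q * (\<psi> y * P) = Q * P * diagonal ?n a"
      using diag[OF that(1)] assoc_mult_mat[OF Q P D] by simp
    then have "Q * (\<psi> y * P) = diagonal ?n a" using D by (simp add: QP)
    then show ?thesis using that(2,3) by (simp del: index_mult_mat)
  qed
  show ?thesis
  proof (intro exI conjI allI impI)
    show "matrix_coordinates scale d (\<lambda>y i j. (Q * (\<psi> y * P)) $$ (i, j))"
      by (rule coordinates_of_conjugation(1)[OF P Q PQ QP])
    show "mat_trace (\<psi> y) = (\<Sum>i\<le>d. (Q * (\<psi> y * P)) $$ (i, i))" for y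
      by (rule coordinates_of_conjugation(2)[OF P Q PQ QP])
    show "(Q * (\<psi> x * P)) $$ (i, j) = (if i = j then \<theta> i else 0)" if "i \<le> d" "j \<le> d" for i j
      using v(3) that by (rule entries)
    show "(Q * (\<psi> (E r) * P)) $$ (i, j) = (if i = r \<and> j = r then 1 else 0)"
      if "r \<le> d" "i \<le> d" "j \<le> d" for r i j
      using entries[of "E r" "\<lambda>k. if k = r then 1 else 0" i j] Ev[of r] that by auto
  qed
qed

end

section \<open>Leonard systems in coordinates\<close>

lemma poly_tau: "poly (tau t i) x = (\<Prod>j<i. x - t j)"
  by (simp only: tau_def poly_prod poly_pCons poly_0) simp

lemma tau_Suc: "tau t (Suc i) = [:- t i, 1:] * tau t i"
  by (simp only: tau_def lessThan_Suc prod.insert finite_lessThan lessThan_iff less_irrefl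
      not_False_eq_True)

lemma tau_neq_0: "tau t i \<noteq> 0"
proof (induction i)
  case (Suc i)
  then show ?case unfolding tau_Suc by (simp del: mult_pCons_left)
qed (simp add: tau_def)

lemma degree_tau: "degree (tau t i) = i"
proof (induction i)
  case (Suc i)
  then show ?case
    unfolding tau_Suc by (subst degree_mult_eq) (simp_all add: tau_neq_0)
qed (simp add: tau_def)

text \<open>
  A Leonard system in coordinates that make \<open>As\<close> diagonal, with the primitive idempotents of \<open>A\<close>
  given by their multiplication rules instead of as products. Unlike the defining list products, these
  conditions are visibly invariant under reversing the order of the \<open>E\<^sub>i\<close> or of the \<open>E\<^sup>*\<^sub>i\<close>, so each
  statement below also holds for the reversed systems.
\<close>
locale leonard_frame = matrix_coordinates scale d ent
  for scale :: "'k::field \<Rightarrow> 'a::ring_1 \<Rightarrow> 'a" and d and ent +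
  fixes \<psi> :: "'a \<Rightarrow> 'k mat" and A :: 'a and E :: "nat \<Rightarrow> 'a" and \<theta> :: "nat \<Rightarrow> 'k"
    and As :: 'a and Es :: "nat \<Rightarrow> 'a" and \<theta>s :: "nat \<Rightarrow> 'k"
  assumes trace_ent: "mat_trace (\<psi> x) = (\<Sum>i\<le>d. ent x i i)"
    and ent_As: "\<lbrakk>i \<le> d; j \<le> d\<rbrakk> \<Longrightarrow> ent As i j = (if i = j then \<theta>s i else 0)"
    and ent_Es: "\<lbrakk>r \<le> d; i \<le> d; j \<le> d\<rbrakk> \<Longrightarrow> ent (Es r) i j = (if i = r \<and> j = r then 1 else 0)"
    and inj_\<theta>: "\<lbrakk>i \<le> d; j \<le> d; \<theta> i = \<theta> j\<rbrakk> \<Longrightarrow> i = j"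
    and inj_\<theta>s: "\<lbrakk>i \<le> d; j \<le> d; \<theta>s i = \<theta>s j\<rbrakk> \<Longrightarrow> i = j"
    and E_mult: "\<lbrakk>i \<le> d; j \<le> d\<rbrakk> \<Longrightarrow> E i * E j = (if i = j then E i else 0)"
    and E_sum: "(\<Sum>r\<le>d. E r) = 1"
    and E_nonzero: "r \<le> d \<Longrightarrow> E r \<noteq> 0"
    and A_eq: "A = (\<Sum>r\<le>d. scale (\<theta> r) (E r))"
    and tridiag_As: "tridiagonal_wrt d E As"
    and tridiag_A: "tridiagonal_wrt d Es A"
begin

abbreviation pA :: "'k poly \<Rightarrow> 'a" where "pA p \<equiv> poly_at scale p A"

lemma spectral_mult:
  "(\<Sum>r\<le>d. scale (f r) (E r)) * (\<Sum>r\<le>d. scale (g r) (E r)) = (\<Sum>r\<le>d. scale (f r * g r) (E r))"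
proof -
  have "(\<Sum>r\<le>d. scale (f r) (E r)) * (\<Sum>r\<le>d. scale (g r) (E r)) =
     (\<Sum>r\<le>d. \<Sum>s\<le>d. scale (g s) (scale (f r) (E r * E s)))"
    by (simp only: sum_product scale_mult_left scale_mult_right)
  also have "\<dots> = (\<Sum>r\<le>d. \<Sum>s\<le>d. if s = r then scale (f r * g r) (E r) else 0)"
    by (intro sum.cong refl) (auto simp: E_mult mult.commute)
  finally show ?thesis by simp
qed

lemma power_A: "A ^ n = (\<Sum>r\<le>d. scale (\<theta> r ^ n) (E r))"
proof (induction n)
  case 0
  then show ?case by (simp add: E_sum)
next
  case (Suc n)
  then show ?case by (simp add: A_eq spectral_mult)
qed

lemma pA_spectral: "pA p = (\<Sum>r\<le>d. scale (poly p (\<theta> r)) (E r))"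
proof -
  have "pA p = (\<Sum>i\<le>degree p. \<Sum>r\<le>d. scale (coeff p i * \<theta> r ^ i) (E r))"
    by (simp add: poly_at_def power_A scale_sum_right)
  also have "\<dots> = (\<Sum>r\<le>d. \<Sum>i\<le>degree p. scale (coeff p i * \<theta> r ^ i) (E r))"
    by (rule sum.swap)
  finally show ?thesis by (simp add: poly_altdef scale_sum_left)
qed

lemma pA_mult: "pA (p * q) = pA p * pA q"
  by (simp add: pA_spectral spectral_mult)

lemma pA_add: "pA (p + q) = pA p + pA q"
  by (simp add: pA_spectral scale_left_distrib sum.distrib)

lemma pA_smult: "pA (Polynomial.smult c p) = scale c (pA p)"
  by (simp add: pA_spectral scale_sum_right)

lemma pA_diff: "pA (p - q) = pA p - pA q"
  by (simp add: pA_spectral scale_left_diff_distrib sum_subtractf)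

lemma pA_zero: "pA 0 = 0"
  by (simp add: pA_spectral)

lemma E_pA: "r \<le> d \<Longrightarrow> E r * pA p = scale (poly p (\<theta> r)) (E r)"
proof -
  assume r: "r \<le> d"
  have "E r * pA p = (\<Sum>s\<le>d. if s = r then scale (poly p (\<theta> r)) (E r) else 0)"
    unfolding pA_spectral sum_distrib_left
    by (rule sum.cong) (auto simp: r E_mult scale_mult_right)
  then show ?thesis using r by simp
qed

lemma ent_A_zero: "\<lbrakk>i \<le> d; j \<le> d; \<bar>int i - int j\<bar> > 1\<rbrakk> \<Longrightarrow> ent A i j = 0"
  and ent_A_nonzero: "\<lbrakk>i \<le> d; j \<le> d; \<bar>int i - int j\<bar> = 1\<rbrakk> \<Longrightarrow> ent A i j \<noteq> 0"
proof -
  have EsA: "ent (Es i * A) k l = (if k = i then ent A i l else 0)"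
    if "i \<le> d" "k \<le> d" "l \<le> d" for i k l
  proof -
    have "ent (Es i * A) k l = (\<Sum>m\<le>d. if m = i then (if k = i then ent A i l else 0) else 0)"
      unfolding ent_mult[OF that(2,3)] by (rule sum.cong) (auto simp: ent_Es that)
    then show ?thesis using that by simp
  qed
  have EsAEs: "ent (Es i * A * Es j) k l = (if k = i \<and> l = j then ent A i j else 0)"
    if "i \<le> d" "j \<le> d" "k \<le> d" "l \<le> d" for i j k l
  proof -
    have "ent (Es i * A * Es j) k l =
      (\<Sum>m\<le>d. if m = j then (if k = i \<and> l = j then ent A i j else 0) else 0)"
      unfolding ent_mult[OF that(3,4)] by (rule sum.cong) (auto simp: ent_Es EsA that)
    then show ?thesis using that by simp
  qed
  show "ent A i j = 0" if "i \<le> d" "j \<le> d" "\<bar>int i - int j\<bar> > 1"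
    using tridiag_A EsAEs[of i j i j] that by (simp add: tridiagonal_wrt_def ent_zero)
  show "ent A i j \<noteq> 0" if ij: "i \<le> d" "j \<le> d" "\<bar>int i - int j\<bar> = 1"
  proof
    assume "ent A i j = 0"
    then have "Es i * A * Es j = 0"
      by (intro ent_ext) (simp add: EsAEs ij ent_zero)
    then show False using tridiag_A ij by (simp add: tridiagonal_wrt_def)
  qed
qed

lemma ent_mult_Es0: 
  assumes "i \<le> d" "j \<le> d"
  shows "ent (x * Es 0) i j = (if j = 0 then ent x i 0 else 0)"
proof -
  have "ent (x * Es 0) i j = (\<Sum>m\<le>d. if m = 0 then (if j = 0 then ent x i 0 else 0) else 0)"
    unfolding ent_mult[OF assms] by (rule sum.cong) (auto simp: ent_Es assms)
  then show ?thesis by simp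
qed

text \<open>
  Right multiplication by \<open>Es 0\<close> keeps only the column with index \<open>0\<close>. Elements \<open>x * Es 0\<close> thus play
  the role of vectors, with \<open>Es 0\<close> as the vector spanning the eigenspace for \<open>\<theta>s 0\<close>.
\<close>
lemma mult_Es0_eqI:
  "(\<And>i. i \<le> d \<Longrightarrow> ent x i 0 = ent y i 0) \<Longrightarrow> x * Es 0 = y * Es 0"
  by (rule ent_ext) (simp add: ent_mult_Es0)

lemma mult_Es0_eqD:
  "x * Es 0 = y * Es 0 \<Longrightarrow> i \<le> d \<Longrightarrow> ent x i 0 = ent y i 0"
  using ent_mult_Es0[of i 0 x] ent_mult_Es0[of i 0 y] by simp

lemma trace_mult_Es0: "mat_trace (\<psi> (x * Es 0)) = ent x 0 0"
proof -
  have "mat_trace (\<psi> (x * Es 0)) = (\<Sum>i\<le>d. if i = 0 then ent x 0 0 else 0)"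
    unfolding trace_ent by (rule sum.cong) (auto simp: ent_mult_Es0)
  then show ?thesis by simp
qed

lemma ent_shift_As:
  assumes "i \<le> d" "j \<le> d"
  shows "ent ((As - scale t 1) * x) i j = (\<theta>s i - t) * ent x i j"
    and "ent (x * (As - scale t 1)) i j = (\<theta>s j - t) * ent x i j"
proof -
  have e: "ent (As - scale t 1) k l = (if k = l then \<theta>s k - t else 0)" if "k \<le> d" "l \<le> d" for k l
    using that by (simp add: ent_diff ent_As ent_scale ent_one)
  have "ent ((As - scale t 1) * x) i j = (\<Sum>k\<le>d. if k = i then (\<theta>s i - t) * ent x i j else 0)"
    unfolding ent_mult[OF assms] by (rule sum.cong) (auto simp: e assms)
  then show "ent ((As - scale t 1) * x) i j = (\<theta>s i - t) * ent x i j" using assms by simp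
  have "ent (x * (As - scale t 1)) i j = (\<Sum>k\<le>d. if k = j then (\<theta>s j - t) * ent x i j else 0)"
    unfolding ent_mult[OF assms] by (rule sum.cong) (auto simp: e assms)
  then show "ent (x * (As - scale t 1)) i j = (\<theta>s j - t) * ent x i j" using assms by simp
qed

section \<open>The cyclic vector\<close>

text \<open>Each factor of a tridiagonal matrix reaches at most one row further down.\<close>
lemma ent_power_A_zero: "\<lbrakk>j \<le> d; n < j\<rbrakk> \<Longrightarrow> ent (A ^ n) j 0 = 0"
proof (induction n arbitrary: j)
  case 0
  then show ?case by (simp add: ent_one)
next
  case (Suc n)
  have "ent A j k * ent (A ^ n) k 0 = 0" if "k \<le> d" for k
  proof (cases "n < k")
    case True
    then show ?thesis using Suc.IH that by simp
  next
    case False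
    then have "ent A j k = 0" using Suc.prems that by (intro ent_A_zero) auto
    then show ?thesis by simp
  qed
  then have "(\<Sum>k\<le>d. ent A j k * ent (A ^ n) k 0) = 0"
    by (intro sum.neutral) blast
  then show ?case using Suc.prems by (simp add: ent_mult)
qed

text \<open>
  Only one path of length \<open>n\<close> leads from index \<open>0\<close> to index \<open>n\<close>, so the entry is the product of the
  nonzero subdiagonal entries of \<open>A\<close>.
\<close>
lemma ent_power_A_nonzero: "n \<le> d \<Longrightarrow> ent (A ^ n) n 0 \<noteq> 0"
proof (induction n)
  case 0
  then show ?case by (simp add: ent_one)
next
  case (Suc n)
  have "ent (A ^ Suc n) (Suc n) 0 =
    (\<Sum>k\<le>d. if k = n then ent A (Suc n) n * ent (A ^ n) n 0 else 0)"
    unfolding power_Suc ent_mult[OF Suc.prems le0]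
  proof (rule sum.cong)
    fix k assume k: "k \<in> {..d}"
    consider "k < n" | "k = n" | "n < k" by linarith
    then show "ent A (Suc n) k * ent (A ^ n) k 0 =
      (if k = n then ent A (Suc n) n * ent (A ^ n) n 0 else 0)"
    proof cases
      case 1
      then have "ent A (Suc n) k = 0" using Suc.prems k by (intro ent_A_zero) auto
      then show ?thesis using 1 by simp
    next
      case 3
      then show ?thesis using k ent_power_A_zero[of k n] by simp
    qed simp
  qed simp
  then show ?case using Suc ent_A_nonzero[of "Suc n" n] by simp
qed

lemma ent_pA_above_degree: "\<lbrakk>j \<le> d; degree p < j\<rbrakk> \<Longrightarrow> ent (pA p) j 0 = 0"
  unfolding poly_at_def by (simp add: ent_sum ent_scale ent_power_A_zero)

lemma ent_pA_degree: 
  assumes "degree p \<le> d" "p \<noteq> 0"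
  shows "ent (pA p) (degree p) 0 \<noteq> 0"
proof -
  have "ent (pA p) (degree p) 0 =
    (\<Sum>i\<le>degree p. if i = degree p then lead_coeff p * ent (A ^ degree p) (degree p) 0 else 0)"
    unfolding poly_at_def ent_sum[OF assms(1) le0]
    by (rule sum.cong) (use assms in \<open>auto simp: ent_scale ent_power_A_zero\<close>)
  then show ?thesis using assms ent_power_A_nonzero[of "degree p"] by simp
qed

text \<open>
  Gaussian elimination from the last nonzero entry upwards: by the preceding lemmas the column of a
  polynomial of degree \<open>i\<close> in \<open>A\<close> ends exactly at row \<open>i\<close>.
\<close>
lemma column_eq_poly:
  assumes "i \<le> Suc d" "\<And>j. \<lbrakk>i \<le> j; j \<le> d\<rbrakk> \<Longrightarrow> ent w j 0 = 0"
  shows "\<exists>p. (p = 0 \<or> degree p < i) \<and> w * Es 0 = pA p * Es 0"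
  using assms
proof (induction i arbitrary: w)
  case 0
  then have "w * Es 0 = 0 * Es 0" by (intro mult_Es0_eqI) (simp add: ent_zero)
  then show ?case by (intro exI[of _ 0]) (simp add: pA_zero)
next
  case (Suc i)
  define c where "c = ent w i 0 / ent (pA (monom 1 i)) i 0"
  have i: "i \<le> d" using Suc.prems by simp
  have nz: "ent (pA (monom 1 i)) i 0 \<noteq> 0"
    using ent_pA_degree[of "monom 1 i"] i by (simp add: degree_monom_eq)
  have "\<exists>p. (p = 0 \<or> degree p < i) \<and> (w - pA (Polynomial.smult c (monom 1 i))) * Es 0 = pA p * Es 0"
  proof (rule Suc.IH)
    fix j assume j: "i \<le> j" "j \<le> d"
    show "ent (w - pA (Polynomial.smult c (monom 1 i))) j 0 = 0"
    proof (cases "j = i")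
      case True
      then show ?thesis using nz i
        by (simp add: ent_diff pA_smult ent_scale c_def del: smult_monom)
    next
      case False
      then show ?thesis using j Suc.prems(2)[of j] ent_pA_above_degree[of j "monom 1 i"]
        by (simp add: ent_diff pA_smult ent_scale degree_monom_eq del: smult_monom)
    qed
  qed (use i in simp)
  then obtain p where p: "p = 0 \<or> degree p < i"
    "(w - pA (Polynomial.smult c (monom 1 i))) * Es 0 = pA p * Es 0" by blast
  have "w * Es 0 = pA (p + Polynomial.smult c (monom 1 i)) * Es 0"
    using p(2) by (simp add: pA_add algebra_simps del: smult_monom)
  moreover have "degree (p + Polynomial.smult c (monom 1 i)) < Suc i"
    using p(1) by (intro degree_add_less) (auto simp: degree_monom_eq intro: le_less_trans[OF degree_monom_le])
  ultimately show ?case by blast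
qed

lemma column_eq_poly': "\<exists>p. w * Es 0 = pA p * Es 0"
  using column_eq_poly[of "Suc d" w] by auto

lemma annihilates_columns:
  assumes "\<And>w. y * (w * Es 0) = 0"
  shows "y = 0"
proof (rule ent_ext)
  fix i j assume ij: "i \<le> d" "j \<le> d"
  obtain w where w: "\<forall>k\<le>d. \<forall>l\<le>d. ent w k l = (if k = j then 1 else 0)"
    using ent_surj[of "\<lambda>k l. if k = j then 1 else 0"] by auto
  have "ent (y * w) i 0 = (\<Sum>k\<le>d. if k = j then ent y i j else 0)"
    unfolding ent_mult[OF ij(1) le0] by (rule sum.cong) (auto simp: w)
  moreover have "ent (y * w) i 0 = 0"
    using assms[of w] ent_mult_Es0[OF ij(1) le0, of "y * w"] ij by (simp add: mult.assoc ent_zero)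
  ultimately show "ent y i j = ent 0 i j" using ij by (simp add: ent_zero)
qed

text \<open>
  Every column is a polynomial in \<open>A\<close> applied to \<open>Es 0\<close>, and \<open>E r\<close> commutes with such a polynomial up
  to a scalar. If \<open>E r\<close> killed \<open>Es 0\<close>, it would therefore kill all columns.
\<close>
lemma E_Es0_nonzero:
  assumes "r \<le> d"
  shows "E r * Es 0 \<noteq> 0"
proof
  assume z: "E r * Es 0 = 0"
  have "E r * (w * Es 0) = 0" for w
  proof -
    obtain p where "w * Es 0 = pA p * Es 0" using column_eq_poly' by blast
    then have "E r * (w * Es 0) = scale (poly p (\<theta> r)) (E r * Es 0)"
      by (simp add: mult.assoc[symmetric] E_pA assms scale_mult_left)
    then show ?thesis by (simp add: z)
  qed
  then show False using annihilates_columns E_nonzero[OF assms] by blast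
qed

lemma offdiag_Es0_nonzero:
  assumes "r < d"
  shows "E r * As * E (Suc r) * Es 0 \<noteq> 0"
proof
  assume z: "E r * As * E (Suc r) * Es 0 = 0"
  have "E r * As * E (Suc r) * (w * Es 0) = 0" for w
  proof -
    obtain p where "w * Es 0 = pA p * Es 0" using column_eq_poly' by blast
    then have "E r * As * E (Suc r) * (w * Es 0) = E r * As * (E (Suc r) * pA p) * Es 0"
      by (simp add: mult.assoc)
    then show ?thesis using assms z by (simp add: E_pA scale_mult_left scale_mult_right)
  qed
  then have "E r * As * E (Suc r) = 0" by (rule annihilates_columns)
  then show False using assms tridiag_As by (simp add: tridiagonal_wrt_def)
qed

section \<open>The split sequences\<close>

lemma poly_tau_eq_0: "r < i \<Longrightarrow> poly (tau \<theta> i) (\<theta> r) = 0"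
  unfolding poly_tau by (rule prod_zero) auto

lemma poly_tau_neq_0:
  assumes "i \<le> r" "r \<le> d"
  shows "poly (tau \<theta> i) (\<theta> r) \<noteq> 0"
proof -
  have "\<theta> r \<noteq> \<theta> j" if "j < i" for j
    using inj_\<theta>[of r j] assms that by auto
  then show ?thesis unfolding poly_tau by auto
qed

text \<open>
  The factor \<open>tau \<theta> i\<close> kills \<open>E s\<close> for \<open>s < i\<close>, and from the remaining \<open>E s\<close> the tridiagonal \<open>As\<close>
  reaches \<open>E r\<close> with \<open>r < i\<close> only when \<open>s = i\<close>.
\<close>
lemma E_shift_As_tau:
  assumes "r < i" "i \<le> d"
  shows "E r * ((As - scale t 1) * pA (tau \<theta> i)) = scale (poly (tau \<theta> i) (\<theta> i)) (E r * As * E i)"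
proof -
  have "E r * As * pA (tau \<theta> i) = (\<Sum>s\<le>d. scale (poly (tau \<theta> i) (\<theta> s)) (E r * As * E s))"
    by (simp add: pA_spectral sum_distrib_left scale_mult_right)
  also have "\<dots> = (\<Sum>s\<le>d. if s = i then scale (poly (tau \<theta> i) (\<theta> i)) (E r * As * E i) else 0)"
  proof (rule sum.cong)
    fix s assume s: "s \<in> {..d}"
    consider "s < i" | "s = i" | "i < s" by linarith
    then show "scale (poly (tau \<theta> i) (\<theta> s)) (E r * As * E s) =
      (if s = i then scale (poly (tau \<theta> i) (\<theta> i)) (E r * As * E i) else 0)"
    proof cases
      case 3
      then have "E r * As * E s = 0" using tridiag_As assms s by (simp add: tridiagonal_wrt_def)
      then show ?thesis using 3 by simp
    qed (auto simp: poly_tau_eq_0)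
  qed simp
  also have "\<dots> = scale (poly (tau \<theta> i) (\<theta> i)) (E r * As * E i)" using assms by simp
  finally have "E r * As * pA (tau \<theta> i) = scale (poly (tau \<theta> i) (\<theta> i)) (E r * As * E i)" .
  moreover have "E r * ((As - scale t 1) * pA (tau \<theta> i))
      = E r * As * pA (tau \<theta> i) - scale t (E r * pA (tau \<theta> i))"
    by (simp only: left_diff_distrib right_diff_distrib scale_mult_left scale_mult_right
        mult.assoc mult_1_left)
  ultimately show ?thesis using assms by (simp add: E_pA poly_tau_eq_0)
qed

text \<open>
  The left-hand side \<open>w\<close> is confined from two sides. Its rows from \<open>Suc i\<close> on vanish: that row is
  annihilated by the shift and the later ones by the degree; hence \<open>w = p(A) Es 0\<close> with \<open>p\<close> of degree
  at most \<open>i\<close>. On the other hand \<open>E r * w = 0\<close> for \<open>r < i\<close>, so \<open>p\<close> vanishes at \<open>\<theta> 0, \<dots>, \<theta> (i - 1)\<close>.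
  Together these make \<open>p\<close> a multiple of \<open>tau \<theta> i\<close>. The factor is nonzero because the component
  \<open>E i * w\<close> contains the nonzero block \<open>E i * As * E (Suc i)\<close>.
\<close>
lemma split_exists:
  assumes "i < d"
  shows "\<exists>f. f \<noteq> 0 \<and>
    (As - scale (\<theta>s (Suc i)) 1) * pA (tau \<theta> (Suc i)) * Es 0 = scale f (pA (tau \<theta> i) * Es 0)"
proof -
  let ?w = "(As - scale (\<theta>s (Suc i)) 1) * pA (tau \<theta> (Suc i))"
  have "\<exists>p. (p = 0 \<or> degree p < Suc i) \<and> ?w * Es 0 = pA p * Es 0"
  proof (rule column_eq_poly)
    fix j assume j: "Suc i \<le> j" "j \<le> d"
    have "\<theta>s j - \<theta>s (Suc i) = 0 \<or> ent (pA (tau \<theta> (Suc i))) j 0 = 0"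
      using j by (cases "j = Suc i") (auto intro!: ent_pA_above_degree simp: degree_tau)
    then show "ent ?w j 0 = 0" using j by (auto simp: ent_shift_As)
  qed (use assms in simp)
  then obtain p where p: "p = 0 \<or> degree p < Suc i" and wp: "?w * Es 0 = pA p * Es 0" by blast
  have E_w: "scale (poly p (\<theta> r)) (E r * Es 0)
      = scale (poly (tau \<theta> (Suc i)) (\<theta> (Suc i))) (E r * As * E (Suc i) * Es 0)" if "r \<le> i" for r
  proof -
    have "scale (poly p (\<theta> r)) (E r * Es 0) = E r * (?w * Es 0)"
      using that assms by (simp add: wp mult.assoc[symmetric] E_pA scale_mult_left)
    also have "\<dots> = (E r * ?w) * Es 0" by (simp only: mult.assoc)
    finally show ?thesis
      using that assms by (simp add: E_shift_As_tau scale_mult_left)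
  qed
  have p0: "poly p (\<theta> r) = 0" if "r < i" for r
  proof -
    have "E r * As * E (Suc i) = 0"
      using that assms tridiag_As by (simp add: tridiagonal_wrt_def)
    then show ?thesis using E_w[of r] that assms E_Es0_nonzero[of r] by simp
  qed
  define f where "f = poly p (\<theta> i) / poly (tau \<theta> i) (\<theta> i)"
  have "p = Polynomial.smult f (tau \<theta> i)"
  proof (rule poly_eqI_degree[where A = "\<theta> ` {..i}"])
    have card: "card (\<theta> ` {..i}) = Suc i"
      using inj_\<theta> assms by (subst card_image) (auto simp: inj_on_def)
    show "degree p < card (\<theta> ` {..i})" using p card by auto
    show "degree (Polynomial.smult f (tau \<theta> i)) < card (\<theta> ` {..i})"
      using card degree_smult_le[of f "tau \<theta> i"] by (simp add: degree_tau)
    fix x assume "x \<in> \<theta> ` {..i}"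
    then obtain r where "r \<le> i" "x = \<theta> r" by auto
    then show "poly p x = poly (Polynomial.smult f (tau \<theta> i)) x"
      using p0[of r] poly_tau_eq_0[of r i] poly_tau_neq_0[of i i] assms
      by (cases "r = i") (auto simp: f_def)
  qed
  moreover have "poly p (\<theta> i) \<noteq> 0"
    using E_w[of i] offdiag_Es0_nonzero[OF assms] poly_tau_neq_0[of "Suc i" "Suc i"] assms by auto
  then have "f \<noteq> 0" using poly_tau_neq_0[of i i] assms by (simp add: f_def)
  ultimately show ?thesis using wp by (auto simp: pA_smult scale_mult_left)
qed

text \<open>
  The entry at \<open>(0, 0)\<close> of the split relation ties consecutive traces together by nonzero factors.
\<close>
lemma trace_tau_nonzero: "i \<le> d \<Longrightarrow> ent (pA (tau \<theta> i)) 0 0 \<noteq> 0"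
  and first_split_trace: "i < d \<Longrightarrow> first_split scale \<psi> A \<theta> Es \<theta>s (Suc i) =
     (\<theta>s 0 - \<theta>s (Suc i)) * (ent (pA (tau \<theta> (Suc i))) 0 0 / ent (pA (tau \<theta> i)) 0 0)"
proof -
  show "ent (pA (tau \<theta> i)) 0 0 \<noteq> 0" if "i \<le> d"
    using that
  proof (induction i)
    case 0
    have "pA (tau \<theta> 0) = 1" by (simp add: pA_spectral tau_def E_sum)
    then show ?case by (simp add: ent_one)
  next
    case (Suc i)
    then obtain f where f: "f \<noteq> 0"
      "(As - scale (\<theta>s (Suc i)) 1) * pA (tau \<theta> (Suc i)) * Es 0 = scale f (pA (tau \<theta> i)) * Es 0"
      using split_exists[of i] by (auto simp: scale_mult_left)
    from mult_Es0_eqD[OF f(2), of 0] show ?case using f(1) Suc by (auto simp: ent_shift_As ent_scale)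
  qed
qed (simp add: first_split_def trace_mult_Es0)

text \<open>The same entry identifies the factor with the first split sequence.\<close>
lemma split:
  assumes "i < d"
  shows "(As - scale (\<theta>s (Suc i)) 1) * pA (tau \<theta> (Suc i)) * Es 0
      = scale (first_split scale \<psi> A \<theta> Es \<theta>s (Suc i)) (pA (tau \<theta> i) * Es 0)"
    and "first_split scale \<psi> A \<theta> Es \<theta>s (Suc i) \<noteq> 0"
proof -
  obtain f where f: "f \<noteq> 0"
    "(As - scale (\<theta>s (Suc i)) 1) * pA (tau \<theta> (Suc i)) * Es 0 = scale f (pA (tau \<theta> i) * Es 0)"
    using split_exists[OF assms] by blast
  then have "(As - scale (\<theta>s (Suc i)) 1) * pA (tau \<theta> (Suc i)) * Es 0 = scale f (pA (tau \<theta> i)) * Es 0"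
    by (simp add: scale_mult_left)
  from mult_Es0_eqD[OF this, of 0]
  have "first_split scale \<psi> A \<theta> Es \<theta>s (Suc i) = f"
    using trace_tau_nonzero[of i] assms by (simp add: first_split_trace ent_shift_As ent_scale)
  with f show "(As - scale (\<theta>s (Suc i)) 1) * pA (tau \<theta> (Suc i)) * Es 0
      = scale (first_split scale \<psi> A \<theta> Es \<theta>s (Suc i)) (pA (tau \<theta> i) * Es 0)"
    and "first_split scale \<psi> A \<theta> Es \<theta>s (Suc i) \<noteq> 0" by simp_all
qed

section \<open>Symmetry and reversal\<close>

text \<open>
  An irreducible tridiagonal matrix is symmetric up to conjugation by a diagonal matrix, and hence so
  are all polynomials in it. This is a concrete form of the antiautomorphism of the algebra that
  fixes \<open>A\<close> and \<open>A\<^sup>*\<close>.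
\<close>
lemma symmetrizing_weights:
  "\<exists>\<kappa>. (\<forall>i\<le>d. \<kappa> i \<noteq> 0) \<and>
     (\<forall>p. \<forall>i\<le>d. \<forall>j\<le>d. \<kappa> i * ent (pA p) i j = \<kappa> j * ent (pA p) j i)"
proof -
  define \<kappa> where "\<kappa> i = (\<Prod>l<i. ent A l (Suc l) / ent A (Suc l) l)" for i
  have nz: "\<kappa> i \<noteq> 0" if "i \<le> d" for i
    using that unfolding \<kappa>_def by (auto simp: ent_A_nonzero)
  have step: "\<kappa> l * ent A l (Suc l) = \<kappa> (Suc l) * ent A (Suc l) l" if "l < d" for l
    using that ent_A_nonzero[of "Suc l" l] by (simp add: \<kappa>_def)
  have symA: "\<kappa> i * ent A i j = \<kappa> j * ent A j i" if "i \<le> d" "j \<le> d" for i j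
  proof -
    consider "i = j" | "j = Suc i" | "i = Suc j" | "\<bar>int i - int j\<bar> > 1" by linarith
    then show ?thesis
    proof cases
      case 4
      then show ?thesis using that by (simp add: ent_A_zero)
    qed (use step that in auto)
  qed
  have sympow: "\<kappa> i * ent (A ^ n) i j = \<kappa> j * ent (A ^ n) j i" if "i \<le> d" "j \<le> d" for n i j
    using that
  proof (induction n arbitrary: i j)
    case 0
    then show ?case by (simp add: ent_one)
  next
    case (Suc n)
    have "\<kappa> i * ent (A * A ^ n) i j = (\<Sum>k\<le>d. (\<kappa> i * ent A i k) * ent (A ^ n) k j)"
      by (simp add: ent_mult Suc.prems sum_distrib_left mult.assoc)
    also have "\<dots> = (\<Sum>k\<le>d. ent A k i * (\<kappa> k * ent (A ^ n) k j))"
      by (rule sum.cong) (simp_all add: symA Suc.prems)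
    also have "\<dots> = (\<Sum>k\<le>d. \<kappa> j * (ent (A ^ n) j k * ent A k i))"
      by (rule sum.cong) (simp_all add: Suc)
    also have "\<dots> = \<kappa> j * ent (A ^ n * A) j i"
      by (simp add: ent_mult Suc.prems sum_distrib_left)
    finally show ?case by (simp add: power_commutes)
  qed
  have "\<kappa> i * ent (pA p) i j = \<kappa> j * ent (pA p) j i" if "i \<le> d" "j \<le> d" for p i j
    unfolding poly_at_def
    by (simp add: that ent_sum ent_scale sum_distrib_left mult.left_commute[of "\<kappa> _"] sympow)
  then show ?thesis using nz by blast
qed

lemma split_column:
  assumes "i < d" "j \<le> d"
  shows "ent ((As - scale (\<theta>s (Suc i)) 1) * pA (tau \<theta> (Suc i))) j 0
    = first_split scale \<psi> A \<theta> Es \<theta>s (Suc i) * ent (pA (tau \<theta> i)) j 0"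
proof -
  have "(As - scale (\<theta>s (Suc i)) 1) * pA (tau \<theta> (Suc i)) * Es 0
      = scale (first_split scale \<psi> A \<theta> Es \<theta>s (Suc i)) (pA (tau \<theta> i)) * Es 0"
    using split(1)[OF assms(1)] by (simp add: scale_mult_left)
  from mult_Es0_eqD[OF this assms(2)] show ?thesis using assms by (simp add: ent_scale)
qed

text \<open>
  The transpose of \<open>split_column\<close>; it has the same factor because the rescaling relates column \<open>0\<close>
  and row \<open>0\<close> of both polynomials by the same weights.
\<close>
lemma split_row:
  assumes "i < d" "j \<le> d"
  shows "ent (pA (tau \<theta> (Suc i)) * (As - scale (\<theta>s (Suc i)) 1)) 0 j
    = first_split scale \<psi> A \<theta> Es \<theta>s (Suc i) * ent (pA (tau \<theta> i)) 0 j"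
proof -
  obtain \<kappa> where nz: "\<And>i. i \<le> d \<Longrightarrow> \<kappa> i \<noteq> 0"
    and sym: "\<And>p i j. \<lbrakk>i \<le> d; j \<le> d\<rbrakk> \<Longrightarrow> \<kappa> i * ent (pA p) i j = \<kappa> j * ent (pA p) j i"
    using symmetrizing_weights by blast
  let ?f = "first_split scale \<psi> A \<theta> Es \<theta>s (Suc i)"
  have "\<kappa> 0 * ent (pA (tau \<theta> (Suc i)) * (As - scale (\<theta>s (Suc i)) 1)) 0 j
      = (\<theta>s j - \<theta>s (Suc i)) * (\<kappa> 0 * ent (pA (tau \<theta> (Suc i))) 0 j)"
    using assms by (simp add: ent_shift_As)
  also have "\<dots> = \<kappa> j * ent ((As - scale (\<theta>s (Suc i)) 1) * pA (tau \<theta> (Suc i))) j 0"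
    using assms by (simp add: ent_shift_As sym[of 0 j])
  also have "\<dots> = ?f * (\<kappa> j * ent (pA (tau \<theta> i)) j 0)"
    by (simp add: split_column[OF assms])
  also have "\<dots> = \<kappa> 0 * (?f * ent (pA (tau \<theta> i)) 0 j)"
    using assms by (simp add: sym[of 0 j, symmetric])
  finally show ?thesis using nz[of 0] by simp
qed

lemma tridiagonal_reverse: "tridiagonal_wrt d F y \<Longrightarrow> tridiagonal_wrt d (\<lambda>i. F (d - i)) y"
  unfolding tridiagonal_wrt_def
proof (intro allI impI)
  fix i j assume *: "\<forall>i\<le>d. \<forall>j\<le>d. (1 < \<bar>int i - int j\<bar> \<longrightarrow> F i * y * F j = 0) \<and>
     (\<bar>int i - int j\<bar> = 1 \<longrightarrow> F i * y * F j \<noteq> 0)" and ij: "i \<le> d" "j \<le> d"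
  have "\<bar>int (d - i) - int (d - j)\<bar> = \<bar>int i - int j\<bar>" using ij by linarith
  then show "(1 < \<bar>int i - int j\<bar> \<longrightarrow> F (d - i) * y * F (d - j) = 0) \<and>
     (\<bar>int i - int j\<bar> = 1 \<longrightarrow> F (d - i) * y * F (d - j) \<noteq> 0)"
    using *[rule_format, of "d - i" "d - j"] by simp
qed

lemma sum_reverse: "(\<Sum>k\<le>d. f (d - k)) = (\<Sum>k\<le>d. f k :: 'b::comm_monoid_add)"
  by (rule sum.reindex_bij_witness[of _ "\<lambda>k. d - k" "\<lambda>k. d - k"]) auto

lemma reverse_E: "leonard_frame scale d ent \<psi> A (\<lambda>i. E (d - i)) (\<lambda>i. \<theta> (d - i)) As Es \<theta>s"
proof unfold_locales
  show "\<lbrakk>i \<le> d; j \<le> d; \<theta> (d - i) = \<theta> (d - j)\<rbrakk> \<Longrightarrow> i = j" for i j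
    using inj_\<theta>[of "d - i" "d - j"] by simp
  show "\<lbrakk>i \<le> d; j \<le> d\<rbrakk> \<Longrightarrow> E (d - i) * E (d - j) = (if i = j then E (d - i) else 0)" for i j
    by (auto simp: E_mult)
  show "(\<Sum>r\<le>d. E (d - r)) = 1" using E_sum by (simp add: sum_reverse)
  show "A = (\<Sum>r\<le>d. scale (\<theta> (d - r)) (E (d - r)))"
    using A_eq by (simp add: sum_reverse[of "\<lambda>r. scale (\<theta> r) (E r)"])
qed (simp_all add: trace_ent ent_As ent_Es inj_\<theta>s E_nonzero tridiag_A tridiag_As tridiagonal_reverse)

lemma reverse_Es:
  "leonard_frame scale d (\<lambda>x i j. ent x (d - i) (d - j)) \<psi> A E \<theta> As
     (\<lambda>i. Es (d - i)) (\<lambda>i. \<theta>s (d - i))"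
proof unfold_locales
  show "\<lbrakk>i \<le> d; j \<le> d\<rbrakk> \<Longrightarrow> ent (x * y) (d - i) (d - j) =
      (\<Sum>k\<le>d. ent x (d - i) (d - k) * ent y (d - k) (d - j))" for i j x y
    by (simp add: ent_mult sum_reverse[of "\<lambda>k. ent x (d - i) k * ent y k (d - j)"])
  show "x = y" if "\<And>i j. \<lbrakk>i \<le> d; j \<le> d\<rbrakk> \<Longrightarrow> ent x (d - i) (d - j) = ent y (d - i) (d - j)" for x y
  proof (rule ent_ext)
    show "ent x i j = ent y i j" if "i \<le> d" "j \<le> d" for i j
      using \<open>\<And>i j. \<lbrakk>i \<le> d; j \<le> d\<rbrakk> \<Longrightarrow> ent x (d - i) (d - j) = ent y (d - i) (d - j)\<close>[of "d - i" "d - j"]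
        that by simp
  qed
  show "\<exists>x. \<forall>i\<le>d. \<forall>j\<le>d. ent x (d - i) (d - j) = f i j" for f
    using ent_surj[of "\<lambda>i j. f (d - i) (d - j)"] by (metis diff_diff_cancel diff_le_self)
  show "mat_trace (\<psi> x) = (\<Sum>i\<le>d. ent x (d - i) (d - i))" for x
    by (simp add: trace_ent sum_reverse[of "\<lambda>i. ent x i i"])
  show "\<lbrakk>i \<le> d; j \<le> d; \<theta>s (d - i) = \<theta>s (d - j)\<rbrakk> \<Longrightarrow> i = j" for i j
    using inj_\<theta>s[of "d - i" "d - j"] by simp
  show "\<lbrakk>i \<le> d; j \<le> d\<rbrakk> \<Longrightarrow> ent As (d - i) (d - j) = (if i = j then \<theta>s (d - i) else 0)" for i j
    by (auto simp: ent_As)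
  show "\<lbrakk>i \<le> d; j \<le> d\<rbrakk> \<Longrightarrow> ent 1 (d - i) (d - j) = (if i = j then 1 else 0)" for i j
    by (auto simp: ent_one)
  show "\<lbrakk>r \<le> d; i \<le> d; j \<le> d\<rbrakk> \<Longrightarrow>
      ent (Es (d - r)) (d - i) (d - j) = (if i = r \<and> j = r then 1 else 0)" for r i j
    by (auto simp: ent_Es)
  show "\<lbrakk>i \<le> d; j \<le> d; \<theta> i = \<theta> j\<rbrakk> \<Longrightarrow> i = j" for i j by (rule inj_\<theta>)
qed (simp_all add: scale_mult_left scale_mult_right ent_add ent_scale E_mult E_sum E_nonzero A_eq[symmetric]
      tridiag_A tridiag_As tridiagonal_reverse)

lemma second_split_eq_first_split:
  "second_split scale d \<psi> A \<theta> Es \<theta>s i = first_split scale \<psi> A (\<lambda>i. \<theta> (d - i)) Es \<theta>s i"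
  by (simp add: second_split_def first_split_def eta_def tau_def)

text \<open>
  Evaluate the entry at \<open>(0, d)\<close> of \<open>\<eta>\<^sub>m\<^sub>+\<^sub>1(A) (A\<^sup>* - t) \<tau>\<^sub>i\<^sub>+\<^sub>1(A)\<close>, where \<open>i + m + 1 = d\<close>. Acting to the left,
  \<open>A\<^sup>*\<close> produces the second split sequence of the system; acting to the right, the first split sequence
  of the reversed system.
\<close>
lemma first_split_reverse_Es:
  assumes "i < d"
  shows "first_split scale \<psi> A \<theta> (\<lambda>i. Es (d - i)) (\<lambda>i. \<theta>s (d - i)) (Suc i)
    = second_split scale d \<psi> A \<theta> Es \<theta>s (d - i)"
proof -
  interpret rev_E: leonard_frame scale d ent \<psi> A "\<lambda>i. E (d - i)" "\<lambda>i. \<theta> (d - i)" As Es \<theta>s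
    by (rule reverse_E)
  interpret rev_Es: leonard_frame scale d "\<lambda>x i j. ent x (d - i) (d - j)" \<psi> A E \<theta> As
    "\<lambda>i. Es (d - i)" "\<lambda>i. \<theta>s (d - i)"
    by (rule reverse_Es)
  define m where "m = d - Suc i"
  have m: "m < d" "d - i = Suc m" "d - Suc i = m" "d - m = Suc i" using assms by (auto simp: m_def)
  define f where "f = first_split scale \<psi> A \<theta> (\<lambda>i. Es (d - i)) (\<lambda>i. \<theta>s (d - i)) (Suc i)"
  define g where "g = second_split scale d \<psi> A \<theta> Es \<theta>s (Suc m)"
  let ?\<eta> = "tau (\<lambda>i. \<theta> (d - i))"
  have row: "ent (pA (?\<eta> (Suc m)) * (As - scale (\<theta>s (Suc m)) 1)) 0 j = g * ent (pA (?\<eta> m)) 0 j"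
    if "j \<le> d" for j
    using rev_E.split_row[OF m(1) that] by (simp add: g_def second_split_eq_first_split)
  have column: "ent ((As - scale (\<theta>s m) 1) * pA (tau \<theta> (Suc i))) j d = f * ent (pA (tau \<theta> i)) j d"
    if "j \<le> d" for j
    using rev_Es.split_column[OF assms, of "d - j"] that by (simp add: f_def m)
  \<comment> \<open>As this product vanishes, the shift \<open>t\<close> may be chosen separately for the two actions.\<close>
  have vanish: "pA (?\<eta> (Suc m) * tau \<theta> (Suc i)) = 0"
  proof -
    have "poly (?\<eta> (Suc m) * tau \<theta> (Suc i)) (\<theta> r) = 0" if "r \<le> d" for r
      using that m rev_E.poly_tau_eq_0[of "d - r" "Suc m"] poly_tau_eq_0[of r "Suc i"]
      by (cases "r \<le> i") auto
    then show ?thesis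
      unfolding pA_spectral by (intro sum.neutral) (simp del: poly_mult)
  qed
  have "g * ent (pA (?\<eta> m * tau \<theta> (Suc i))) 0 d
      = ent (pA (?\<eta> (Suc m)) * (As - scale (\<theta>s (Suc m)) 1) * pA (tau \<theta> (Suc i))) 0 d"
  proof -
    have "ent (pA (?\<eta> (Suc m)) * (As - scale (\<theta>s (Suc m)) 1) * pA (tau \<theta> (Suc i))) 0 d
        = (\<Sum>k\<le>d. (g * ent (pA (?\<eta> m)) 0 k) * ent (pA (tau \<theta> (Suc i))) k d)"
      by (subst ent_mult) (simp_all add: row)
    then show ?thesis
      by (simp only: pA_mult ent_mult[OF le0 order_refl] sum_distrib_left mult.assoc)
  qed
  also have "pA (?\<eta> (Suc m)) * (As - scale (\<theta>s (Suc m)) 1) * pA (tau \<theta> (Suc i))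
      = pA (?\<eta> (Suc m)) * ((As - scale (\<theta>s m) 1) * pA (tau \<theta> (Suc i)))"
  proof -
    have "pA (?\<eta> (Suc m)) * (As - scale t 1) * pA (tau \<theta> (Suc i))
      = pA (?\<eta> (Suc m)) * As * pA (tau \<theta> (Suc i))" for t
      using vanish unfolding pA_mult
      by (simp add: right_diff_distrib left_diff_distrib scale_mult_left scale_mult_right)
    then show ?thesis by (simp only: mult.assoc)
  qed
  also have "ent \<dots> 0 d = f * ent (pA (?\<eta> (Suc m) * tau \<theta> i)) 0 d"
  proof -
    have "ent (pA (?\<eta> (Suc m)) * ((As - scale (\<theta>s m) 1) * pA (tau \<theta> (Suc i)))) 0 d
        = (\<Sum>k\<le>d. ent (pA (?\<eta> (Suc m))) 0 k * (f * ent (pA (tau \<theta> i)) k d))"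
      by (subst ent_mult) (simp_all add: column)
    then show ?thesis
      by (simp only: pA_mult ent_mult[OF le0 order_refl] sum_distrib_left mult.left_commute)
  qed
  finally have gf: "g * ent (pA (?\<eta> m * tau \<theta> (Suc i))) 0 d = f * ent (pA (?\<eta> (Suc m) * tau \<theta> i)) 0 d" .
  \<comment> \<open>The remaining polynomials of degree \<open>d\<close> are both monic, so their entries at \<open>(0, d)\<close> coincide.\<close>
  have "?\<eta> m * tau \<theta> (Suc i) - ?\<eta> (Suc m) * tau \<theta> i
      = Polynomial.smult (\<theta> (d - m) - \<theta> i) (?\<eta> m * tau \<theta> i)"
    by (simp add: tau_Suc algebra_simps smult_diff_left)
  then have "ent (pA (?\<eta> m * tau \<theta> (Suc i))) 0 d - ent (pA (?\<eta> (Suc m) * tau \<theta> i)) 0 d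
      = (\<theta> (d - m) - \<theta> i) * ent (pA (?\<eta> m * tau \<theta> i)) 0 d"
    by (metis ent_diff ent_scale pA_diff pA_smult le0 order_refl)
  also have "ent (pA (?\<eta> m * tau \<theta> i)) 0 d = 0"
    using rev_Es.ent_pA_above_degree[of d "?\<eta> m * tau \<theta> i"] m assms
    by (simp add: degree_mult_eq tau_neq_0 degree_tau)
  finally have eq: "ent (pA (?\<eta> m * tau \<theta> (Suc i))) 0 d = ent (pA (?\<eta> (Suc m) * tau \<theta> i)) 0 d" by simp
  have "degree (?\<eta> m * tau \<theta> (Suc i)) = d"
    using m assms by (simp add: degree_mult_eq tau_neq_0 degree_tau)
  then have "ent (pA (?\<eta> m * tau \<theta> (Suc i))) 0 d \<noteq> 0"
    using rev_Es.ent_pA_degree[of "?\<eta> m * tau \<theta> (Suc i)"] by (simp add: tau_neq_0)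
  with gf eq have "f = g" by simp
  then show ?thesis by (simp add: f_def g_def m)
qed

section \<open>Polynomials in A mapping the range of Es 0 into that of Es d\<close>

text \<open>
  The component in \<open>E i\<close> of a split relation. The vector \<open>y\<close> is arbitrary so that this applies both to
  \<open>Es 0\<close> and to its image in the eigenspace of \<open>Es d\<close>.
\<close>
lemma E_split:
  assumes "i < d" "(As - scale t 1) * pA (tau \<theta> (Suc i)) * y = scale f (pA (tau \<theta> i) * y)"
  shows "scale (poly (tau \<theta> (Suc i)) (\<theta> (Suc i))) (E i * As * E (Suc i) * y)
    = scale (f * poly (tau \<theta> i) (\<theta> i)) (E i * y)"
proof -
  have "scale (poly (tau \<theta> (Suc i)) (\<theta> (Suc i))) (E i * As * E (Suc i) * y)
      = E i * ((As - scale t 1) * pA (tau \<theta> (Suc i))) * y"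
    using assms(1) by (simp add: E_shift_As_tau scale_mult_left)
  also have "\<dots> = E i * ((As - scale t 1) * pA (tau \<theta> (Suc i)) * y)" by (simp only: mult.assoc)
  also have "\<dots> = scale f (E i * pA (tau \<theta> i) * y)"
    unfolding assms(2) by (simp only: scale_mult_right mult.assoc)
  finally show ?thesis using assms(1) by (simp add: E_pA scale_mult_left)
qed

lemma mult_Es0_eq_Esd:
  assumes "\<And>j. j < d \<Longrightarrow> ent x j 0 = 0"
  shows "Es d * (x * Es 0) = x * Es 0"
proof (rule ent_ext)
  fix i j assume ij: "i \<le> d" "j \<le> d"
  have "ent (Es d * (x * Es 0)) i j = (\<Sum>k\<le>d. if k = d then (if i = d then ent (x * Es 0) d j else 0) else 0)"
    unfolding ent_mult[OF ij] by (rule sum.cong) (auto simp: ent_Es ij)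
  then show "ent (Es d * (x * Es 0)) i j = ent (x * Es 0) i j"
    using ij assms[of i] by (auto simp: ent_mult_Es0)
qed

text \<open>
  The column of \<open>pA p\<close> lies in the eigenspace of \<open>Es d\<close>, so it satisfies the split relation of the
  reversed system. Both this relation and the one for \<open>Es 0\<close> involve the same vector
  \<open>E i * As * E (Suc i) * Es 0\<close>, which can be eliminated.
\<close>
lemma eigenvalue_ratio:
  assumes "i < d" "\<And>j. j < d \<Longrightarrow> ent (pA p) j 0 = 0"
  shows "first_split scale \<psi> A \<theta> Es \<theta>s (Suc i) * poly p (\<theta> (Suc i))
    = second_split scale d \<psi> A \<theta> Es \<theta>s (d - i) * poly p (\<theta> i)"
proof -
  interpret rev_Es: leonard_frame scale d "\<lambda>x i j. ent x (d - i) (d - j)" \<psi> A E \<theta> As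
    "\<lambda>i. Es (d - i)" "\<lambda>i. \<theta>s (d - i)"
    by (rule reverse_Es)
  define f g where "f = first_split scale \<psi> A \<theta> Es \<theta>s (Suc i)"
    and "g = second_split scale d \<psi> A \<theta> Es \<theta>s (d - i)"
  let ?y = "pA p * Es 0" and ?c = "poly (tau \<theta> (Suc i)) (\<theta> (Suc i))"
  let ?e = "E i * As * E (Suc i) * Es 0"
  have "(As - scale (\<theta>s (d - Suc i)) 1) * pA (tau \<theta> (Suc i)) * Es d * ?y
      = scale g (pA (tau \<theta> i) * Es d) * ?y"
    using rev_Es.split(1)[OF assms(1)] by (simp add: first_split_reverse_Es[OF assms(1)] g_def)
  then have "(As - scale (\<theta>s (d - Suc i)) 1) * pA (tau \<theta> (Suc i)) * ?y = scale g (pA (tau \<theta> i) * ?y)"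
    using mult_Es0_eq_Esd[OF assms(2)] by (simp add: mult.assoc scale_mult_left)
  from E_split[OF assms(1) this]
  have "scale ?c (E i * As * (E (Suc i) * pA p) * Es 0)
      = scale (g * poly (tau \<theta> i) (\<theta> i)) ((E i * pA p) * Es 0)"
    by (simp only: mult.assoc)
  then have 1: "scale (poly p (\<theta> (Suc i))) (scale ?c ?e)
      = scale (g * poly (tau \<theta> i) (\<theta> i) * poly p (\<theta> i)) (E i * Es 0)"
    using assms(1) by (simp add: E_pA scale_mult_left scale_mult_right mult.commute)
  have "scale ?c ?e = scale (f * poly (tau \<theta> i) (\<theta> i)) (E i * Es 0)"
    by (rule E_split[OF assms(1) split(1)[OF assms(1), folded f_def]])
  with 1 have "scale (poly p (\<theta> (Suc i)) * (f * poly (tau \<theta> i) (\<theta> i))) (E i * Es 0)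
      = scale (g * poly (tau \<theta> i) (\<theta> i) * poly p (\<theta> i)) (E i * Es 0)" by simp
  then have "poly p (\<theta> (Suc i)) * (f * poly (tau \<theta> i) (\<theta> i))
      = g * poly (tau \<theta> i) (\<theta> i) * poly p (\<theta> i)"
    using E_Es0_nonzero[of i] assms(1) by simp
  then show ?thesis using poly_tau_neq_0[of i i] assms(1)
    by (simp add: f_def g_def mult.commute)
qed

abbreviation S where "S \<equiv> switching_element scale d \<psi> A E \<theta> Es \<theta>s"

lemma multiple_of_switching_element:
  assumes "\<And>j. j < d \<Longrightarrow> ent (pA p) j 0 = 0"
  shows "pA p = scale (poly p (\<theta> 0)) S"
proof -
  let ?f = "first_split scale \<psi> A \<theta> Es \<theta>s" and ?g = "second_split scale d \<psi> A \<theta> Es \<theta>s"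
  have coefficient: "poly p (\<theta> r) = poly p (\<theta> 0) * ((\<Prod>h\<in>{Suc d - r..d}. ?g h) / (\<Prod>h\<in>{1..r}. ?f h))"
    if "r \<le> d" for r
    using that
  proof (induction r)
    case (Suc r)
    have "Suc d - Suc r = d - r" "Suc d - r = Suc (d - r)" using Suc.prems by auto
    then have "(\<Prod>h\<in>{Suc d - Suc r..d}. ?g h) = ?g (d - r) * (\<Prod>h\<in>{Suc d - r..d}. ?g h)"
      by (simp only: prod.atLeast_Suc_atMost[OF diff_le_self])
    moreover have "poly p (\<theta> (Suc r)) = ?g (d - r) * poly p (\<theta> r) / ?f (Suc r)"
    proof -
      have "?f (Suc r) * poly p (\<theta> (Suc r)) = ?g (d - r) * poly p (\<theta> r)"
        using Suc.prems assms by (intro eigenvalue_ratio) auto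
      moreover have "?f (Suc r) \<noteq> 0" using Suc.prems by (intro split(2)) auto
      ultimately show ?thesis by (metis nonzero_mult_div_cancel_left)
    qed
    moreover have "(\<Prod>h\<in>{1..Suc r}. ?f h) = ?f (Suc r) * (\<Prod>h\<in>{1..r}. ?f h)"
      by (subst prod.nat_ivl_Suc') simp_all
    moreover have "poly p (\<theta> r)
        = poly p (\<theta> 0) * ((\<Prod>h\<in>{Suc d - r..d}. ?g h) / (\<Prod>h\<in>{1..r}. ?f h))"
      by (rule Suc.IH) (use Suc.prems in simp)
    ultimately show ?case
      by (simp only: times_divide_eq_left times_divide_eq_right divide_divide_eq_left mult_ac)
  qed simp
  show ?thesis
    unfolding pA_spectral switching_element_def scale_sum_right
  proof (rule sum.cong)
    fix r assume "r \<in> {..d}"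
    then show "scale (poly p (\<theta> r)) (E r) = scale (poly p (\<theta> 0))
        (scale ((\<Prod>h\<in>{Suc d - r..d}. ?g h) / (\<Prod>h\<in>{1..r}. ?f h)) (E r))"
      using coefficient[of r] by (simp only: scale_scale atMost_iff)
  qed simp
qed

lemma ent_pA_0_eq_0:
  assumes "\<And>j. j \<le> d \<Longrightarrow> ent (pA p) j 0 = 0"
  shows "pA p = 0"
proof -
  have "pA p * Es 0 = 0 * Es 0" using assms by (intro mult_Es0_eqI) (simp add: ent_zero)
  then have "scale (poly p (\<theta> r)) (E r * Es 0) = 0" if "r \<le> d" for r
    using that by (simp add: scale_mult_left[symmetric] E_pA[symmetric] mult.assoc)
  then have "poly p (\<theta> r) = 0" if "r \<le> d" for r
    using that E_Es0_nonzero[OF that] by auto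
  then show ?thesis by (simp add: pA_spectral)
qed

text \<open>
  The column with its only nonzero entry in row \<open>d\<close> is \<open>p(A) Es 0\<close> for some \<open>p\<close>. By uniqueness \<open>p(A)\<close> is a
  multiple of the switching element, and the multiple is nonzero.
\<close>
lemma switching_element_maps:
  obtains q where "S = pA q" "\<And>j. j < d \<Longrightarrow> ent S j 0 = 0"
proof -
  obtain w where w: "\<forall>i\<le>d. \<forall>j\<le>d. ent w i j = (if i = d \<and> j = 0 then 1 else 0)"
    using ent_surj[of "\<lambda>i j. if i = d \<and> j = 0 then 1 else 0"] by auto
  obtain p where "w * Es 0 = pA p * Es 0" using column_eq_poly' by blast
  then have p: "ent (pA p) j 0 = (if j = d then 1 else 0)" if "j \<le> d" for j
    using mult_Es0_eqD[of w "pA p" j] that w by auto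
  define c where "c = poly p (\<theta> 0)"
  have pS: "pA p = scale c S"
    unfolding c_def using p by (intro multiple_of_switching_element) simp
  have "c \<noteq> 0"
    using p[of d] pS by (auto simp: ent_zero)
  then have S: "S = scale (1 / c) (pA p)" by (simp add: pS)
  show thesis
  proof
    show "S = pA (Polynomial.smult (1 / c) p)" using S by (simp only: pA_smult)
    show "ent S j 0 = 0" if "j < d" for j
      using that p[of j] by (subst S) (simp add: ent_scale)
  qed
qed

section \<open>The subalgebra generated by A and the module\<close>

lemma generated_subalgebra_A: "generated_subalgebra scale A = range (\<lambda>p. pA p)"
proof
  show "generated_subalgebra scale A \<subseteq> range (\<lambda>p. pA p)"
    unfolding generated_subalgebra_def
  proof (rule hull_minimal)
    have "pA [:0, 1:] = A" unfolding pA_spectral by (simp add: A_eq[symmetric])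
    then have "A \<in> range (\<lambda>p. pA p)" by (intro range_eqI[of _ _ "[:0, 1:]"]) (rule sym)
    then show "{A} \<subseteq> range (\<lambda>p. pA p)" by blast
    have one: "pA 1 = 1" by (simp add: pA_spectral E_sum)
    show "is_subalgebra scale (range (\<lambda>p. pA p))"
      unfolding is_subalgebra_def
    proof (intro conjI ballI allI)
      show "1 \<in> range (\<lambda>p. pA p)" unfolding one[symmetric] by (rule rangeI)
      fix x y assume "x \<in> range (\<lambda>p. pA p)" "y \<in> range (\<lambda>p. pA p)"
      then obtain p q where pq: "x = pA p" "y = pA q" by blast
      show "x + y \<in> range (\<lambda>p. pA p)" unfolding pq pA_add[symmetric] by (rule rangeI)
      show "x * y \<in> range (\<lambda>p. pA p)" unfolding pq pA_mult[symmetric] by (rule rangeI)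
      show "scale c x \<in> range (\<lambda>p. pA p)" for c
        unfolding pq pA_smult[symmetric] by (rule rangeI)
    qed
  qed
  show "range (\<lambda>p. pA p) \<subseteq> generated_subalgebra scale A"
  proof -
    have sub: "pA p \<in> B" if B: "is_subalgebra scale B" "A \<in> B" for p B
    proof -
      have pow: "A ^ n \<in> B" for n
      proof (induction n)
        case 0
        show ?case using B(1) unfolding is_subalgebra_def power_0 by blast
      next
        case (Suc n)
        then show ?case using B unfolding is_subalgebra_def power_Suc by blast
      qed
      have "scale 0 1 \<in> B" using B(1) unfolding is_subalgebra_def by blast
      then have 0: "0 \<in> B" by simp
      have "(\<Sum>i\<in>I. scale (coeff p i) (A ^ i)) \<in> B" for I
      proof (induction I rule: infinite_finite_induct)
        case (insert i I)
        have "scale (coeff p i) (A ^ i) \<in> B"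
          using B(1) pow[of i] unfolding is_subalgebra_def by blast
        then show ?case
          using B(1) insert.IH unfolding is_subalgebra_def sum.insert[OF insert.hyps] by blast
      qed (simp_all add: 0)
      then show ?thesis by (simp add: poly_at_def)
    qed
    show ?thesis
      unfolding generated_subalgebra_def hull_def
    proof (intro subsetI InterI)
      fix x B assume "x \<in> range (\<lambda>p. pA p)" "B \<in> {t. is_subalgebra scale t \<and> {A} \<subseteq> t}"
      then show "x \<in> B" using sub[of B] by blast
    qed
  qed
qed

text \<open>The annihilator of the module is a two-sided ideal, hence zero as soon as it is proper.\<close>
lemma act_faithful:
  fixes act :: "'a \<Rightarrow> 'v::ab_group_add \<Rightarrow> 'v"
  assumes M: "simple_left_module act" and z: "\<And>v. act y v = 0"
  shows "y = 0"
proof (rule ccontr)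
  interpret simple_left_module act by (rule M)
  assume "y \<noteq> 0"
  from one_in_ideal[OF this] obtain u w where uw: "(\<Sum>k\<le>d. u k * y * w k) = 1" by (elim exE)
  have act_zero: "act x 0 = 0" for x
    using act_add_right[of x 0 0] by (simp only: add_0_left add_cancel_right_left)
  have zero_act: "act 0 v = 0" for v
    using act_add_left[of 0 0 v] by (simp only: add_0_left add_cancel_right_left)
  have "act (u k * y * w k) v = 0" for k v
    by (simp only: act_mult z act_zero)
  then have "act (\<Sum>k\<in>I. u k * y * w k) v = 0" for I v
    by (induction I rule: infinite_finite_induct) (simp_all add: zero_act act_add_left)
  from this[of "{..d}"] have "act 1 v = 0" for v unfolding uw .
  then show False using nontrivial by (simp add: act_one)
qed

theorem switching_element_characterization:
  fixes act :: "'a \<Rightarrow> 'v::ab_group_add \<Rightarrow> 'v"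
  assumes M: "simple_left_module act" and X: "X \<noteq> 0"
  shows "(\<exists>c. X = scale c S) \<longleftrightarrow>
      X \<in> generated_subalgebra scale A \<and> act X ` range (act (Es 0)) \<subseteq> range (act (Es d))"
    and "(\<exists>c. X = scale c S) \<Longrightarrow> act X ` range (act (Es 0)) = range (act (Es d))"
proof -
  interpret simple_left_module act by (rule M)
  have multiple: "X \<in> generated_subalgebra scale A \<and> act X ` range (act (Es 0)) = range (act (Es d))"
    if "\<exists>c. X = scale c S"
  proof -
    obtain q where q: "S = pA q" "\<And>j. j < d \<Longrightarrow> ent S j 0 = 0"
      using switching_element_maps by blast
    from that obtain c where c: "X = scale c S" by blast
    have Xp: "X = pA (Polynomial.smult c q)" by (simp only: c q(1) pA_smult)
    have Xj: "ent X j 0 = 0" if "j < d" for j using that q(2) by (simp add: c ent_scale)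
    have Xd: "ent X d 0 \<noteq> 0"
    proof
      assume "ent X d 0 = 0"
      then have "ent X j 0 = 0" if "j \<le> d" for j
        using that Xj[of j] by (cases "j = d") auto
      then have "X = 0" unfolding Xp by (rule ent_pA_0_eq_0)
      then show False using X by simp
    qed
    obtain z where z: "\<forall>i\<le>d. \<forall>j\<le>d. ent z i j = (if i = 0 \<and> j = d then 1 / ent X d 0 else 0)"
      using ent_surj[of "\<lambda>i j. if i = 0 \<and> j = d then 1 / ent X d 0 else 0"] by auto
    \<comment> \<open>This makes the image of \<open>X * Es 0\<close> contain the whole eigenspace of \<open>Es d\<close>.\<close>
    have Xz: "X * Es 0 * z = Es d"
    proof (rule ent_ext)
      fix i j assume ij: "i \<le> d" "j \<le> d"
      have "ent (X * Es 0 * z) i j = (\<Sum>k\<le>d. if k = 0 then ent X i 0 * ent z 0 j else 0)"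
        unfolding ent_mult[OF ij] by (rule sum.cong) (auto simp: ent_mult_Es0 ij)
      then show "ent (X * Es 0 * z) i j = ent (Es d) i j"
        using ij z Xj[of i] Xd by (auto simp: ent_Es)
    qed
    have "act (Es d) v = act X (act (Es 0) (act z v))" for v
      unfolding Xz[symmetric] by (simp only: act_mult)
    moreover have "act X (act (Es 0) v) = act (Es d) (act X (act (Es 0) v))" for v
      using arg_cong[OF mult_Es0_eq_Esd[OF Xj], of "\<lambda>y. act y v"] by (simp only: act_mult)
    ultimately have "act X ` range (act (Es 0)) = range (act (Es d))" by blast
    then show ?thesis using Xp generated_subalgebra_A by auto
  qed
  have "\<exists>c. X = scale c S"
    if "X \<in> generated_subalgebra scale A" and sub: "act X ` range (act (Es 0)) \<subseteq> range (act (Es d))"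
  proof -
    from that(1) obtain p where p: "X = pA p" by (auto simp: generated_subalgebra_A)
    have Esd: "ent (Es d * y) i j = (if i = d then ent y d j else 0)" if "i \<le> d" "j \<le> d" for y i j
    proof -
      have "ent (Es d * y) i j = (\<Sum>k\<le>d. if k = d then (if i = d then ent y d j else 0) else 0)"
        unfolding ent_mult[OF that] by (rule sum.cong) (auto simp: ent_Es that)
      then show ?thesis by simp
    qed
    have idem: "Es d * Es d = Es d" by (rule ent_ext) (auto simp: Esd ent_Es)
    have fixed: "act (Es d) w = w" if "w \<in> range (act (Es d))" for w
    proof -
      from that obtain v where w: "w = act (Es d) v" by blast
      show ?thesis unfolding w act_mult[symmetric] idem ..
    qed
    have same: "act (Es d * X * Es 0) v = act (X * Es 0) v" for v
    proof -
      have "act X (act (Es 0) v) \<in> range (act (Es d))" using sub by blast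
      from fixed[OF this] show ?thesis by (simp only: act_mult)
    qed
    have act_diff: "act (y - z) v = act y v - act z v" for y z v
      using act_add_left[of "y - z" z v] unfolding diff_add_cancel eq_diff_eq by (rule sym)
    have "Es d * X * Es 0 - X * Es 0 = 0"
      by (rule act_faithful[OF M]) (simp only: act_diff same diff_self)
    then have "Es d * X * Es 0 = X * Es 0" by (simp only: right_minus_eq)
    then have "ent X j 0 = 0" if "j < d" for j
      using mult_Es0_eqD[of "Es d * X" X j] Esd[of j 0 X] that by simp
    then show ?thesis using multiple_of_switching_element[of p] p by blast
  qed
  with multiple show "(\<exists>c. X = scale c S) \<longleftrightarrow>
      X \<in> generated_subalgebra scale A \<and> act X ` range (act (Es 0)) \<subseteq> range (act (Es d))"
    and "(\<exists>c. X = scale c S) \<Longrightarrow> act X ` range (act (Es 0)) = range (act (Es d))"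
    by blast+
qed

end

text \<open>
  Coordinates diagonalizing \<open>As\<close> serve as the coordinates of the frame. A second set, diagonalizing \<open>A\<close>,
  is used only to verify the multiplication rules of the \<open>E\<^sub>i\<close>.
\<close>
lemma (in matrix_algebra) leonard_frame_exists:
  assumes L: "leonard_system scale d \<psi> A E As Es"
    and A: "associated_eigenvalues scale d \<psi> A E \<theta>"
    and As: "associated_eigenvalues scale d \<psi> As Es \<theta>s"
  obtains ent where "leonard_frame scale d ent \<psi> A E \<theta> As Es \<theta>s"
proof -
  obtain ent where ent: "matrix_coordinates scale d ent"
    "\<forall>y. mat_trace (\<psi> y) = (\<Sum>i\<le>d. ent y i i)"
    "\<forall>i\<le>d. \<forall>j\<le>d. ent As i j = (if i = j then \<theta>s i else 0)"
    "\<forall>r\<le>d. \<forall>i\<le>d. \<forall>j\<le>d. ent (Es r) i j = (if i = r \<and> j = r then 1 else 0)"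
    using diagonalizing_coordinates[OF As] by (elim exE conjE)
  note ent = ent[rule_format]
  obtain ent' where ent': "matrix_coordinates scale d ent'"
    "\<forall>y. mat_trace (\<psi> y) = (\<Sum>i\<le>d. ent' y i i)"
    "\<forall>i\<le>d. \<forall>j\<le>d. ent' A i j = (if i = j then \<theta> i else 0)"
    "\<forall>r\<le>d. \<forall>i\<le>d. \<forall>j\<le>d. ent' (E r) i j = (if i = r \<and> j = r then 1 else 0)"
    using diagonalizing_coordinates[OF A] by (elim exE conjE)
  note ent' = ent'[rule_format]
  interpret matrix_coordinates scale d ent by (rule ent(1))
  interpret C': matrix_coordinates scale d ent' by (rule ent'(1))
  have inj: "inj_on \<theta> {0..d}" "inj_on \<theta>s {0..d}"
    using A As by (auto simp: associated_eigenvalues_def eigenvalue_ordering_def bij_betw_def)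
  have E_mult: "E i * E j = (if i = j then E i else 0)" if ij: "i \<le> d" "j \<le> d" for i j
  proof (rule C'.ent_ext)
    fix k l assume kl: "k \<le> d" "l \<le> d"
    have "ent' (E i * E j) k l = (\<Sum>m\<le>d. if m = i then (if k = i \<and> i = j \<and> l = j then 1 else 0) else 0)"
      unfolding C'.ent_mult[OF kl] by (rule sum.cong) (auto simp: ent'(4) ij kl)
    then show "ent' (E i * E j) k l = ent' (if i = j then E i else 0) k l"
      using ij kl by (auto simp: ent'(4) C'.ent_zero)
  qed
  have E_sum: "(\<Sum>r\<le>d. E r) = 1"
  proof (rule C'.ent_ext)
    fix k l assume kl: "k \<le> d" "l \<le> d"
    have "ent' (\<Sum>r\<le>d. E r) k l = (\<Sum>r\<le>d. if r = k then (if k = l then 1 else 0) else 0)"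
      unfolding C'.ent_sum[OF kl] by (rule sum.cong) (auto simp: ent'(4) kl)
    then show "ent' (\<Sum>r\<le>d. E r) k l = ent' 1 k l" using kl by (simp add: C'.ent_one)
  qed
  have A_eq: "A = (\<Sum>r\<le>d. scale (\<theta> r) (E r))"
  proof (rule C'.ent_ext)
    fix k l assume kl: "k \<le> d" "l \<le> d"
    have "ent' (\<Sum>r\<le>d. scale (\<theta> r) (E r)) k l = (\<Sum>r\<le>d. if r = k then (if k = l then \<theta> k else 0) else 0)"
      unfolding C'.ent_sum[OF kl] by (rule sum.cong) (auto simp: ent'(4) C'.ent_scale kl)
    then show "ent' A k l = ent' (\<Sum>r\<le>d. scale (\<theta> r) (E r)) k l" using kl by (simp add: ent'(3))
  qed
  have E_nonzero: "E r \<noteq> 0" if "r \<le> d" for r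
    using ent'(4)[OF that that that] C'.ent_zero[OF that that] by auto
  have "leonard_frame scale d ent \<psi> A E \<theta> As Es \<theta>s"
  proof unfold_locales
    show "i = j" if "i \<le> d" "j \<le> d" "\<theta> i = \<theta> j" for i j
      using inj_onD[OF inj(1) that(3)] that by simp
    show "i = j" if "i \<le> d" "j \<le> d" "\<theta>s i = \<theta>s j" for i j
      using inj_onD[OF inj(2) that(3)] that by simp
    show "tridiagonal_wrt d E As" "tridiagonal_wrt d Es A"
      using L by (auto simp: leonard_system_def)
  qed (fact ent(2) | fact ent(3) | fact ent(4) | fact E_mult | fact E_sum | fact E_nonzero | fact A_eq)+
  then show thesis by (rule that)
qed

section \<open>The characterization of the switching element\<close>

theorem theorem6p7:
  fixes scale :: "'k::field \<Rightarrow> 'a::ring_1 \<Rightarrow> 'a"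
    and d :: nat
    and \<psi> :: "'a \<Rightarrow> 'k mat"
    and act :: "'a \<Rightarrow> 'v::ab_group_add \<Rightarrow> 'v"
    and A As :: 'a
    and E Es :: "nat \<Rightarrow> 'a"
    and \<theta> \<theta>s :: "nat \<Rightarrow> 'k"
    and S :: 'a
  assumes "matrix_algebra scale d \<psi>"
    and "simple_left_module act"
    and "leonard_system scale d \<psi> A E As Es"
    and "associated_eigenvalues scale d \<psi> A E \<theta>"
    and "associated_eigenvalues scale d \<psi> As Es \<theta>s"
    and "S = switching_element scale d \<psi> A E \<theta> Es \<theta>s"
  shows "\<forall>X. X \<noteq> 0 \<longrightarrow>
    ((\<exists>c. X = scale c S) \<longleftrightarrow>
      (X \<in> generated_subalgebra scale A \<and> act X ` range (act (Es 0)) \<subseteq> range (act (Es d)))) \<and>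
    ((\<exists>c. X = scale c S) \<and>
      (X \<in> generated_subalgebra scale A \<and> act X ` range (act (Es 0)) \<subseteq> range (act (Es d)))
      \<longrightarrow> act X ` range (act (Es 0)) = range (act (Es d)))"
proof (intro allI impI)
  fix X :: 'a assume X: "X \<noteq> 0"
  interpret matrix_algebra scale d \<psi> by (rule assms(1))
  obtain ent where frame: "leonard_frame scale d ent \<psi> A E \<theta> As Es \<theta>s"
    by (rule leonard_frame_exists[OF assms(3-5)])
  show "((\<exists>c. X = scale c S) \<longleftrightarrow>
      (X \<in> generated_subalgebra scale A \<and> act X ` range (act (Es 0)) \<subseteq> range (act (Es d)))) \<and>
    ((\<exists>c. X = scale c S) \<and>
      (X \<in> generated_subalgebra scale A \<and> act X ` range (act (Es 0)) \<subseteq> range (act (Es d)))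
      \<longrightarrow> act X ` range (act (Es 0)) = range (act (Es d)))"
    using leonard_frame.switching_element_characterization[OF frame assms(2) X]
    unfolding assms(6) by blast
qed

end
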